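(* Let $p>1$, $p'=p/(p-1)$, let $\Omega\subset\mathbb{R}^N$ be a bounded domain with Lipschitz boundary, and let $h\in L^{p'}(\Omega)\setminus\{0\}$ satisfy $\int_\Omega h\,dx=0$. Let $u\in W^{1,p}(\Omega)$ be the unique function with $\int_\Omega u\,dx=0$ and $$\int_\Omega|\nabla u|^{p-2}\nabla u\cdot\nabla\xi\,dx=\int_\Omega h\xi\,dx\quad\text{for any }\xi\in W^{1,p}(\Omega).$$ Then for any $v\in W^{1,p}(\Omega)$, $$\|\nabla(u-v)\|_p\le C\,\|F'(v)\|_{*,W^{1,p}}^{\frac{1}{\max\{1,p-1\}}}\le C\inf_{\eta^*\in Q^*_\nu}\Bigl(\|\tau^*-\eta^*\|_{p'}+C_P\|\mathrm{div}\,\eta^*+h\|_{p'}+C_T\|\eta^*\cdot\nu\|_{p',\partial\Omega}\Bigr)^{\frac{1}{\max\{1,p-1\}}},$$ where $\tau^*:=|\nabla v|^{p-2}\nabla v$ and $$C=\begin{cases}2^{\frac{p-2}{p-1}},& p\ge2,\\ (p-1)^{-1}\,2^{\frac{2-p}{p}}\left(C_P^{p'}\|h\|_{p'}^{p'}+\|\nabla v\|_p^p\right)^{\frac{2-p}{p}},& p<2.\end{cases}$$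
   Context: $\|\cdot\|_q$ is the norm of $L^q(\Omega)$, $\|\cdot\|_{q,\partial\Omega}$ the norm of $L^q(\partial\Omega)$; $|a|^{p-2}a:=0$ for $a=0$. For $v,w\in W^{1,p}(\Omega)$, $$\langle F'(v),w\rangle=\int_\Omega|\nabla v|^{p-2}\nabla v\cdot\nabla w\,dx-\int_\Omega hw\,dx,\qquad \|F'(v)\|_{*,W^{1,p}}:=\sup_{w\in W^{1,p}(\Omega)\setminus\{0\},\ \int_\Omega w\,dx=0}\frac{|\langle F'(v),w\rangle|}{\|\nabla w\|_p}.$$ $C_P$ and $C_T$ are constants in the Poincar\'e and trace inequalities $$\|w\|_p\le C_P\|\nabla w\|_p,\qquad \|w\|_{p,\partial\Omega}\le C_T\|\nabla w\|_p\qquad\text{for any }w\in W^{1,p}(\Omega)\text{ with }\int_\Omega w\,dx=0.$$ With $\nu$ the unit outward normal to $\partial\Omega$, $$Q^*_\nu=\{\eta\in L^{p'}(\Omega;\mathbb{R}^N):\ \mathrm{div}\,\eta\in L^{p'}(\Omega),\ \eta\cdot\nu\in L^{p'}(\partial\Omega)\},$$ where the divergence is distributional and $\eta\cdot\nu$ is the normal trace, characterized by $\int_\Omega\eta\cdot\nabla\xi\,dx+\int_\Omega(\mathrm{div}\,\eta)\,\xi\,dx=\int_{\partial\Omega}\xi\,(\eta\cdot\nu)\,dS$ for $\xi\in W^{1,p}(\Omega)$. *)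

theory Defs
  imports "HOL-Analysis.Analysis"
begin

definition Lp :: "real \<Rightarrow> 'a measure \<Rightarrow> ('a \<Rightarrow> 'b::euclidean_space) set" where
  "Lp q M = {f \<in> borel_measurable M. integrable M (\<lambda>x. norm (f x) powr q)}"

definition Lp_norm :: "real \<Rightarrow> 'a measure \<Rightarrow> ('a \<Rightarrow> 'b::euclidean_space) \<Rightarrow> real" where
  "Lp_norm q M f = (LINT x|M. norm (f x) powr q) powr (1 / q)"

definition conj_exp :: "real \<Rightarrow> real" where
  "conj_exp p = p / (p - 1)"

text \<open>Near each boundary point the set is the open epigraph, in some direction \<open>e\<close>,
  of a Lipschitz function on the hyperplane orthogonal to \<open>e\<close>.\<close>

definition lipschitz_boundary :: "'a::euclidean_space set \<Rightarrow> bool" where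
  "lipschitz_boundary \<Omega> \<longleftrightarrow>
     (\<forall>x0 \<in> frontier \<Omega>. \<exists>r>0. \<exists>e \<gamma> L. norm e = 1 \<and> L-lipschitz_on {y. y \<bullet> e = 0} \<gamma> \<and>
        \<Omega> \<inter> ball x0 r = {x \<in> ball x0 r. \<gamma> (x - (x \<bullet> e) *\<^sub>R e) < x \<bullet> e})"

definition bounded_lipschitz_domain :: "'a::euclidean_space set \<Rightarrow> bool" where
  "bounded_lipschitz_domain \<Omega> \<longleftrightarrow>
     open \<Omega> \<and> connected \<Omega> \<and> \<Omega> \<noteq> {} \<and> bounded \<Omega> \<and> lipschitz_boundary \<Omega>"

text \<open>Hausdorff measure of dimension \<open>k\<close>, normalised so that it agrees with Lebesgue measure
  on \<open>k\<close>-dimensional planes. The empty set is treated separately since \<open>0 ^ 0 = 1\<close>: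
  for \<open>k = 0\<close> this is counting measure. The outer measure is metric, hence countably additive
  on Borel sets, as \<^const>\<open>measure_of\<close> requires to give a nonzero measure.\<close>

definition hausdorff_pre :: "nat \<Rightarrow> real \<Rightarrow> 'a::euclidean_space set \<Rightarrow> ennreal" where
  "hausdorff_pre k \<delta> A =
     (INF C \<in> {C :: nat \<Rightarrow> 'a set. A \<subseteq> (\<Union>i. C i) \<and> (\<forall>i. bounded (C i) \<and> diameter (C i) \<le> \<delta>)}.
        \<Sum>i. if C i = {} then 0
            else ennreal (unit_ball_vol (real k) * (diameter (C i) / 2) ^ k))"

definition hausdorff_outer :: "nat \<Rightarrow> 'a::euclidean_space set \<Rightarrow> ennreal" where
  "hausdorff_outer k A = (SUP \<delta> \<in> {0<..}. hausdorff_pre k \<delta> A)"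

definition hausdorff_measure :: "nat \<Rightarrow> 'a::euclidean_space measure" where
  "hausdorff_measure k = measure_of UNIV (sets borel) (hausdorff_outer k)"

definition surface_measure :: "'a::euclidean_space set \<Rightarrow> 'a measure" where
  "surface_measure \<Omega> = restrict_space (hausdorff_measure (DIM('a) - 1)) (frontier \<Omega>)"

primrec Ck :: "nat \<Rightarrow> ('a::euclidean_space \<Rightarrow> real) \<Rightarrow> bool" where
  "Ck 0 f \<longleftrightarrow> continuous_on UNIV f"
| "Ck (Suc k) f \<longleftrightarrow> (\<forall>x. f differentiable (at x)) \<and>
     (\<forall>b\<in>Basis. Ck k (\<lambda>x. frechet_derivative f (at x) b))"

definition smooth :: "('a::euclidean_space \<Rightarrow> real) \<Rightarrow> bool" where
  "smooth f \<longleftrightarrow> (\<forall>k. Ck k f)"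

definition grad :: "('a::euclidean_space \<Rightarrow> real) \<Rightarrow> 'a \<Rightarrow> 'a" where
  "grad f x = (\<Sum>b\<in>Basis. frechet_derivative f (at x) b *\<^sub>R b)"

definition test_functions :: "'a::euclidean_space set \<Rightarrow> ('a \<Rightarrow> real) set" where
  "test_functions \<Omega> = {\<phi>. smooth \<phi> \<and> compact (closure {x. \<phi> x \<noteq> 0}) \<and>
     closure {x. \<phi> x \<noteq> 0} \<subseteq> \<Omega>}"

definition locally_integrable ::
    "'a::euclidean_space set \<Rightarrow> ('a \<Rightarrow> 'b::euclidean_space) \<Rightarrow> bool" where
  "locally_integrable \<Omega> f \<longleftrightarrow> (\<forall>K. compact K \<and> K \<subseteq> \<Omega> \<longrightarrow> set_integrable lebesgue K f)"

definition is_weak_grad :: "'a::euclidean_space set \<Rightarrow> ('a \<Rightarrow> real) \<Rightarrow> ('a \<Rightarrow> 'a) \<Rightarrow> bool" where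
  "is_weak_grad \<Omega> u g \<longleftrightarrow> locally_integrable \<Omega> u \<and> locally_integrable \<Omega> g \<and>
     (\<forall>\<phi>\<in>test_functions \<Omega>.
        (LINT x|lebesgue_on \<Omega>. u x *\<^sub>R grad \<phi> x) = - (LINT x|lebesgue_on \<Omega>. \<phi> x *\<^sub>R g x))"

definition weak_grad :: "'a::euclidean_space set \<Rightarrow> ('a \<Rightarrow> real) \<Rightarrow> 'a \<Rightarrow> 'a" where
  "weak_grad \<Omega> u = (SOME g. is_weak_grad \<Omega> u g)"

definition W1p :: "real \<Rightarrow> 'a::euclidean_space set \<Rightarrow> ('a \<Rightarrow> real) set" where
  "W1p p \<Omega> = {u \<in> Lp p (lebesgue_on \<Omega>). \<exists>g \<in> Lp p (lebesgue_on \<Omega>). is_weak_grad \<Omega> u g}"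

definition is_weak_div :: "'a::euclidean_space set \<Rightarrow> ('a \<Rightarrow> 'a) \<Rightarrow> ('a \<Rightarrow> real) \<Rightarrow> bool" where
  "is_weak_div \<Omega> \<eta> d \<longleftrightarrow> locally_integrable \<Omega> \<eta> \<and> locally_integrable \<Omega> d \<and>
     (\<forall>\<phi>\<in>test_functions \<Omega>.
        (LINT x|lebesgue_on \<Omega>. \<eta> x \<bullet> grad \<phi> x) = - (LINT x|lebesgue_on \<Omega>. d x * \<phi> x))"

definition weak_div :: "'a::euclidean_space set \<Rightarrow> ('a \<Rightarrow> 'a) \<Rightarrow> 'a \<Rightarrow> real" where
  "weak_div \<Omega> \<eta> = (SOME d. is_weak_div \<Omega> \<eta> d)"

text \<open>The trace is the continuous extension to \<open>W\<^sup>1\<^sup>,\<^sup>p\<close> of the restriction to the boundary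
  of functions smooth up to the boundary, which are dense for Lipschitz domains.\<close>

definition is_trace ::
    "real \<Rightarrow> 'a::euclidean_space set \<Rightarrow> ('a \<Rightarrow> real) \<Rightarrow> ('a \<Rightarrow> real) \<Rightarrow> bool" where
  "is_trace p \<Omega> u t \<longleftrightarrow> t \<in> Lp p (surface_measure \<Omega>) \<and>
     (\<exists>\<phi> :: nat \<Rightarrow> 'a \<Rightarrow> real. (\<forall>n. smooth (\<phi> n)) \<and>
        (\<lambda>n. Lp_norm p (lebesgue_on \<Omega>) (\<lambda>x. \<phi> n x - u x)) \<longlonglongrightarrow> 0 \<and>
        (\<lambda>n. Lp_norm p (lebesgue_on \<Omega>) (\<lambda>x. grad (\<phi> n) x - weak_grad \<Omega> u x)) \<longlonglongrightarrow> 0 \<and>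
        (\<lambda>n. Lp_norm p (surface_measure \<Omega>) (\<lambda>x. \<phi> n x - t x)) \<longlonglongrightarrow> 0)"

text \<open>On a bounded Lipschitz domain every \<open>u \<in> W1p p \<Omega>\<close> has a trace, unique almost everywhere;
  the value \<open>0\<close> only makes the operator total for other arguments.\<close>

definition boundary_trace :: "real \<Rightarrow> 'a::euclidean_space set \<Rightarrow> ('a \<Rightarrow> real) \<Rightarrow> 'a \<Rightarrow> real" where
  "boundary_trace p \<Omega> u = (if \<exists>t. is_trace p \<Omega> u t then SOME t. is_trace p \<Omega> u t else (\<lambda>_. 0))"

definition is_normal_trace ::
    "real \<Rightarrow> 'a::euclidean_space set \<Rightarrow> ('a \<Rightarrow> 'a) \<Rightarrow> ('a \<Rightarrow> real) \<Rightarrow> bool" where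
  "is_normal_trace p \<Omega> \<eta> g \<longleftrightarrow> g \<in> Lp (conj_exp p) (surface_measure \<Omega>) \<and>
     (\<forall>\<xi>\<in>W1p p \<Omega>.
        (LINT x|lebesgue_on \<Omega>. \<eta> x \<bullet> weak_grad \<Omega> \<xi> x) + (LINT x|lebesgue_on \<Omega>. weak_div \<Omega> \<eta> x * \<xi> x)
          = (LINT x|surface_measure \<Omega>. boundary_trace p \<Omega> \<xi> x * g x))"

text \<open>The normal trace is characterised by Green's formula; the normal vector itself is not
  needed.\<close>

definition normal_trace ::
    "real \<Rightarrow> 'a::euclidean_space set \<Rightarrow> ('a \<Rightarrow> 'a) \<Rightarrow> 'a \<Rightarrow> real" where
  "normal_trace p \<Omega> \<eta> = (SOME g. is_normal_trace p \<Omega> \<eta> g)"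

definition Q_nu :: "real \<Rightarrow> 'a::euclidean_space set \<Rightarrow> ('a \<Rightarrow> 'a) set" where
  "Q_nu p \<Omega> = {\<eta> \<in> Lp (conj_exp p) (lebesgue_on \<Omega>).
     (\<exists>d \<in> Lp (conj_exp p) (lebesgue_on \<Omega>). is_weak_div \<Omega> \<eta> d) \<and>
     (\<exists>g. is_normal_trace p \<Omega> \<eta> g)}"

definition p_flux :: "real \<Rightarrow> 'a::euclidean_space \<Rightarrow> 'a" where
  "p_flux p a = norm a powr (p - 2) *\<^sub>R a"

definition dF :: "real \<Rightarrow> 'a::euclidean_space set \<Rightarrow> ('a \<Rightarrow> real) \<Rightarrow> ('a \<Rightarrow> real) \<Rightarrow> ('a \<Rightarrow> real) \<Rightarrow> real"
  where "dF p \<Omega> h v w =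
    (LINT x|lebesgue_on \<Omega>. p_flux p (weak_grad \<Omega> v x) \<bullet> weak_grad \<Omega> w x)
      - (LINT x|lebesgue_on \<Omega>. h x * w x)"

definition dF_norm :: "real \<Rightarrow> 'a::euclidean_space set \<Rightarrow> ('a \<Rightarrow> real) \<Rightarrow> ('a \<Rightarrow> real) \<Rightarrow> real" where
  "dF_norm p \<Omega> h v =
     (SUP w \<in> {w \<in> W1p p \<Omega>. \<not> (AE x in lebesgue_on \<Omega>. w x = 0) \<and> (LINT x|lebesgue_on \<Omega>. w x) = 0}.
        \<bar>dF p \<Omega> h v w\<bar> / Lp_norm p (lebesgue_on \<Omega>) (weak_grad \<Omega> w))"

definition error_const ::
    "real \<Rightarrow> 'a::euclidean_space set \<Rightarrow> real \<Rightarrow> ('a \<Rightarrow> real) \<Rightarrow> ('a \<Rightarrow> real) \<Rightarrow> real" where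
  "error_const p \<Omega> C\<^sub>P h v =
     (if p \<ge> 2 then 2 powr ((p - 2) / (p - 1))
      else inverse (p - 1) * 2 powr ((2 - p) / p) *
        (C\<^sub>P powr conj_exp p * Lp_norm (conj_exp p) (lebesgue_on \<Omega>) h powr conj_exp p
          + Lp_norm p (lebesgue_on \<Omega>) (weak_grad \<Omega> v) powr p) powr ((2 - p) / p))"

end

theory Submission imports Defs begin

text \<open>Write \<open>\<tau>(a) = |a|\<^sup>p\<^sup>-\<^sup>2 a\<close>. Testing the equation for \<open>u\<close> with \<open>w = u - v - c\<close>, where the
  constant \<open>c\<close> makes the mean vanish, gives
  \<open>\<integral> (\<tau>(\<nabla>u) - \<tau>(\<nabla>v)) \<bullet> (\<nabla>u - \<nabla>v) = - \<langle>F'(v), w\<rangle> \<le> \<parallel>F'(v)\<parallel> \<parallel>\<nabla>w\<parallel>\<^sub>p\<close>, and the strong monotonicity of \<open>\<tau>\<close>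
  bounds the left-hand side from below; for \<open>p < 2\<close> the weight \<open>(|\<nabla>u| + |\<nabla>v|)\<^sup>p\<^sup>-\<^sup>2\<close> is removed by
  Hoelder's inequality and the a priori bound \<open>\<parallel>\<nabla>u\<parallel>\<^sub>p\<^sup>p \<le> (C\<^sub>P \<parallel>h\<parallel>\<^sub>p\<^sub>')\<^sup>p\<^sup>'\<close>. The second inequality is Green's
  formula for \<open>\<eta>\<close> followed by Hoelder's inequality. That \<open>C\<^sub>P \<ge> 0\<close> and that the supremum is over a
  nonempty set both come from \<open>w = u\<close>, since \<open>\<nabla>u = 0\<close> would force \<open>h = 0\<close>. Weak gradients and
  divergences are choices, so everything rests on their uniqueness almost everywhere, that is, on the
  fundamental lemma of the calculus of variations.\<close>

subsection \<open>Pointwise monotonicity of the p-flux\<close>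

lemma powr_eq_mult_powr_minus_one: "(x::real) powr r = x * x powr (r - 1)" if "x \<ge> 0"
  \<comment> \<open>At x = 0 both sides vanish, because \<open>0 powr r = 0\<close> for every r,
    even for r = 0.\<close>
  using that by (cases "x = 0") (auto simp: powr_diff)

text \<open>Convexity of the power is invoked for positive x and y. If one of them is 0, the claim
  reduces to \<open>c powr r \<le> c\<close> for a weight c in [0,1].\<close>

lemma powr_weighted_mean_le:
  fixes x y l r :: real
  assumes "r \<ge> 1" "0 \<le> x" "0 \<le> y" "0 \<le> l" "l \<le> 1"
  shows "((1 - l) * x + l * y) powr r \<le> (1 - l) * x powr r + l * y powr r"
proof -
  have scale: "c powr r \<le> c" if "0 \<le> c" "c \<le> 1" for c :: real
    using powr_mono'[OF assms(1) that] that by simp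
  consider "x = 0" | "y = 0" | "x > 0" "y > 0"
    using assms by fastforce
  then show ?thesis
  proof cases
    case 1
    then show ?thesis using scale[of l] assms by (simp add: powr_mult mult_right_mono)
  next
    case 2
    then show ?thesis using scale[of "1 - l"] assms by (simp add: powr_mult mult_right_mono)
  next
    case 3
    then show ?thesis
      using convex_onD[OF powr_convex[OF assms(1)], of l x y] assms by simp
  qed
qed

lemma powr_midpoint_le:
  fixes x y r :: real
  assumes "r \<ge> 1" "0 \<le> x" "0 \<le> y"
  shows "(x + y) powr r \<le> 2 powr (r - 1) * (x powr r + y powr r)"
proof -
  have "((x + y) / 2) powr r \<le> (x powr r + y powr r) / 2"
    using powr_weighted_mean_le[OF assms, of "1/2"] by (simp add: add_divide_distrib)
  then show ?thesis
    using assms by (simp add: powr_divide powr_diff field_simps)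
qed

text \<open>Split off one factor, \<open>x powr r = x * x powr (r - 1)\<close>, and enlarge the
  remaining base to x + y; the exponent r - 1 is nonnegative.\<close>

lemma powr_superadditive:
  fixes x y r :: real
  assumes "r \<ge> 1" "0 \<le> x" "0 \<le> y"
  shows "x powr r + y powr r \<le> (x + y) powr r"
proof -
  have "x * x powr (r - 1) + y * y powr (r - 1) \<le> x * (x + y) powr (r - 1) + y * (x + y) powr (r - 1)"
    using assms by (intro add_mono mult_left_mono powr_mono2) auto
  then show ?thesis
    using assms powr_eq_mult_powr_minus_one[of x r] powr_eq_mult_powr_minus_one[of y r]
      powr_eq_mult_powr_minus_one[of "x + y" r]
    by (simp add: algebra_simps)
qed

lemma powr_subadditive:
  fixes x y r :: real
  assumes "0 < r" "r \<le> 1" "0 \<le> x" "0 \<le> y"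
  shows "(x + y) powr r \<le> x powr r + y powr r"
proof -
  \<comment> \<open>The exponent r - 1 is now at most 0, so the power decreases in a positive base.
    At base 0 \<open>powr\<close> returns 0 and this can fail, but there the factor z
    vanishes.\<close>
  have *: "z * (x + y) powr (r - 1) \<le> z * z powr (r - 1)" if "0 \<le> z" "z \<le> x + y" for z
    using that assms by (cases "z = 0") (auto intro!: mult_left_mono powr_mono2')
  show ?thesis
    using *[of x] *[of y] assms powr_eq_mult_powr_minus_one[of x r] powr_eq_mult_powr_minus_one[of y r]
      powr_eq_mult_powr_minus_one[of "x + y" r]
    by (simp add: algebra_simps)
qed

text \<open>Mean value theorem: the slope r z^(r-1) at a point z between t and s is at least r
  s^(r-1), hence at least r (s+t)^(r-1), since r - 1 is at most 0. The case t = 0 is treated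
  directly, as the power need not be differentiable there.\<close>

lemma powr_diff_ge_tangent:
  fixes s t r :: real
  assumes "0 < r" "r \<le> 1" "0 \<le> t" "t \<le> s"
  shows "r * (s - t) * (s + t) powr (r - 1) \<le> s powr r - t powr r"
proof (cases "t = s")
  case False
  then have st: "t < s" using assms by simp
  have "r * (s - t) * s powr (r - 1) \<le> s powr r - t powr r"
  proof (cases "t = 0")
    case True
    have "r * (s * s powr (r - 1)) \<le> 1 * (s * s powr (r - 1))"
      using assms by (intro mult_right_mono) auto
    then show ?thesis
      using True assms powr_eq_mult_powr_minus_one[of s r] by (simp add: mult.assoc)
  next
    case False
    then have t: "t > 0" using assms by simp
    have "\<exists>z>t. z < s \<and> s powr r - t powr r = (s - t) * (r * z powr (r - 1))"
      using st t by (intro MVT2) (auto intro!: derivative_eq_intros simp: powr_diff)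
    then obtain z where z: "t < z" "z < s" "s powr r - t powr r = (s - t) * (r * z powr (r - 1))"
      by blast
    have "s powr (r - 1) \<le> z powr (r - 1)"
      using z t assms by (intro powr_mono2') auto
    then have "((s - t) * r) * s powr (r - 1) \<le> ((s - t) * r) * z powr (r - 1)"
      using st assms by (intro mult_left_mono) auto
    then show ?thesis
      unfolding z(3) by (simp add: algebra_simps)
  qed
  moreover have "(s + t) powr (r - 1) \<le> s powr (r - 1)"
    using st assms by (intro powr_mono2') auto
  then have "r * (s - t) * (s + t) powr (r - 1) \<le> r * (s - t) * s powr (r - 1)"
    using st assms by (intro mult_left_mono) auto
  ultimately show ?thesis by linarith
qed auto

section \<open>Lower bounds for the pairing of flux differences\<close>

lemma norm_p_flux: "norm (p_flux p a) = norm a powr (p - 1)"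
  unfolding p_flux_def using powr_eq_mult_powr_minus_one[of "norm a" "p - 1"] by simp

text \<open>For scalars x, y one has x a - y b = (x+y)/2 (a-b) + (x-y)/2 (a+b), and the inner
  product of a+b with a-b is |a|^2 - |b|^2. Thus the angle between a and b enters only through
  |a-b|^2.\<close>

lemma p_flux_diff_inner:
  "(p_flux p a - p_flux p b) \<bullet> (a - b)
     = (norm a powr (p - 2) + norm b powr (p - 2)) / 2 * (norm (a - b))\<^sup>2
       + (norm a powr (p - 2) - norm b powr (p - 2)) / 2 * ((norm a)\<^sup>2 - (norm b)\<^sup>2)"
  unfolding p_flux_def power2_norm_eq_inner
  by (simp add: inner_diff_left inner_diff_right inner_commute field_simps)

text \<open>For fixed \<open>|a|\<close> and \<open>|b|\<close> the left-hand side of the monotonicity inequalities below is affine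
  in \<open>|a - b|\<^sup>2\<close>, and the right-hand side is convex in it. It therefore suffices to
  consider parallel and antiparallel vectors.\<close>

lemma norm_diff_square_between:
  fixes a b :: "'a::real_inner"
  obtains l where "0 \<le> l" "l \<le> 1"
    "(norm (a - b))\<^sup>2 = (1 - l) * (norm a - norm b)\<^sup>2 + l * (norm a + norm b)\<^sup>2"
proof -
  define s t where "s = norm a" "t = norm b"
  have lo: "(s - t)\<^sup>2 \<le> (norm (a - b))\<^sup>2"
    unfolding s_t_def using norm_triangle_ineq3[of a b] by (simp add: abs_le_square_iff[symmetric])
  have hi: "(norm (a - b))\<^sup>2 \<le> (s + t)\<^sup>2"
    unfolding s_t_def using norm_triangle_ineq4[of a b] by (simp add: power_mono)
  have "(norm (a - b))\<^sup>2 \<in> closed_segment ((s - t)\<^sup>2) ((s + t)\<^sup>2)"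
    using lo hi by (simp add: closed_segment_eq_real_ivl)
  then show ?thesis
    using that unfolding in_segment s_t_def by auto
qed

text \<open>These are the values of the preceding affine expression at the extreme distances |s - t|
  and s + t, that is, for parallel and for antiparallel vectors of lengths s and t.\<close>

lemma p_flux_endpoints:
  fixes s t p :: real
  assumes "0 \<le> s" "0 \<le> t"
  shows "(s powr (p - 2) + t powr (p - 2)) / 2 * (s - t)\<^sup>2
           + (s powr (p - 2) - t powr (p - 2)) / 2 * (s\<^sup>2 - t\<^sup>2)
         = (s powr (p - 1) - t powr (p - 1)) * (s - t)"
    and "(s powr (p - 2) + t powr (p - 2)) / 2 * (s + t)\<^sup>2
           + (s powr (p - 2) - t powr (p - 2)) / 2 * (s\<^sup>2 - t\<^sup>2)
         = (s powr (p - 1) + t powr (p - 1)) * (s + t)"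
  using powr_eq_mult_powr_minus_one[OF assms(1), of "p - 1"]
    powr_eq_mult_powr_minus_one[OF assms(2), of "p - 1"]
  by (simp_all add: power2_eq_square field_simps)

text \<open>Parallel vectors are handled by superadditivity with exponent p - 1, antiparallel ones
  by midpoint convexity with the same exponent. The latter produces the constant 2^(2-p), which is
  attained at b = -a.\<close>

lemma p_flux_monotone_ge_2:
  assumes "p \<ge> 2"
  shows "2 powr (2 - p) * norm (a - b) powr p \<le> (p_flux p a - p_flux p b) \<bullet> (a - b)"
proof -
  define s t where "s = norm a" "t = norm b"
  have st: "0 \<le> s" "0 \<le> t" by (auto simp: s_t_def)
  define A B where "A = (s powr (p - 2) + t powr (p - 2)) / 2"
    and "B = (s powr (p - 2) - t powr (p - 2)) / 2 * (s\<^sup>2 - t\<^sup>2)"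
  obtain l where l: "0 \<le> l" "l \<le> 1" "(norm (a - b))\<^sup>2 = (1 - l) * (s - t)\<^sup>2 + l * (s + t)\<^sup>2"
    unfolding s_t_def by (rule norm_diff_square_between)
  \<comment> \<open>As a function of x^2 the power |x|^p has exponent p/2, which is at least 1 and
    hence convex; this allows interpolation between the two extremes.\<close>
  have sq: "(x\<^sup>2) powr (p / 2) = \<bar>x\<bar> powr p" for x :: real
  proof (cases "x = 0")
    case False
    then have "x\<^sup>2 = \<bar>x\<bar> powr 2" by (simp add: powr_numeral)
    then show ?thesis by (simp only: powr_powr) simp
  qed (use assms in auto)
  have par: "2 powr (2 - p) * \<bar>s - t\<bar> powr p \<le> A * (s - t)\<^sup>2 + B"
  proof -
    have gen: "\<bar>s - t\<bar> powr p \<le> (s powr (p - 1) - t powr (p - 1)) * (s - t)"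
      if "0 \<le> t" "t \<le> s" for s t
    proof -
      have "(s - t) powr (p - 1) + t powr (p - 1) \<le> s powr (p - 1)"
        using powr_superadditive[of "p - 1" "s - t" t] that assms by simp
      then have "(s - t) powr (p - 1) * (s - t) \<le> (s powr (p - 1) - t powr (p - 1)) * (s - t)"
        using that by (intro mult_right_mono) auto
      then show ?thesis
        using that powr_eq_mult_powr_minus_one[of "s - t" p] by (simp add: mult.commute)
    qed
    have "\<bar>s - t\<bar> powr p \<le> (s powr (p - 1) - t powr (p - 1)) * (s - t)"
      using gen[of t s] gen[of s t] st
      by (cases "t \<le> s") (auto simp: abs_minus_commute algebra_simps)
    moreover have "2 powr (2 - p) * \<bar>s - t\<bar> powr p \<le> 1 * \<bar>s - t\<bar> powr p"
      using assms powr_mono[of "2 - p" 0 2] by (intro mult_right_mono) auto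
    ultimately show ?thesis
      unfolding A_def B_def p_flux_endpoints(1)[OF st] by linarith
  qed
  have anti: "2 powr (2 - p) * \<bar>s + t\<bar> powr p \<le> A * (s + t)\<^sup>2 + B"
  proof -
    have "(s + t) powr (p - 1) \<le> 2 powr (p - 2) * (s powr (p - 1) + t powr (p - 1))"
      using powr_midpoint_le[of "p - 1" s t] st assms by (simp add: algebra_simps)
    then have "2 powr (2 - p) * (s + t) powr (p - 1)
        \<le> 2 powr (2 - p) * (2 powr (p - 2) * (s powr (p - 1) + t powr (p - 1)))"
      by (intro mult_left_mono) auto
    also have "\<dots> = s powr (p - 1) + t powr (p - 1)"
      by (simp add: powr_add[symmetric] mult.assoc[symmetric])
    finally have "2 powr (2 - p) * (s + t) powr (p - 1) * (s + t)
        \<le> (s powr (p - 1) + t powr (p - 1)) * (s + t)"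
      using st by (intro mult_right_mono) auto
    then show ?thesis
      unfolding A_def B_def p_flux_endpoints(2)[OF st]
      using st powr_eq_mult_powr_minus_one[of "s + t" p] by (simp add: algebra_simps)
  qed
  have "norm (a - b) powr p = ((norm (a - b))\<^sup>2) powr (p / 2)"
    by (simp add: sq)
  also have "\<dots> \<le> (1 - l) * \<bar>s - t\<bar> powr p + l * \<bar>s + t\<bar> powr p"
    unfolding l(3) sq[symmetric] using l assms by (intro powr_weighted_mean_le) auto
  finally have "2 powr (2 - p) * norm (a - b) powr p
      \<le> 2 powr (2 - p) * ((1 - l) * \<bar>s - t\<bar> powr p + l * \<bar>s + t\<bar> powr p)"
    by (intro mult_left_mono) auto
  also have "\<dots> = (1 - l) * (2 powr (2 - p) * \<bar>s - t\<bar> powr p) + l * (2 powr (2 - p) * \<bar>s + t\<bar> powr p)"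
    by (simp add: algebra_simps)
  also have "\<dots> \<le> (1 - l) * (A * (s - t)\<^sup>2 + B) + l * (A * (s + t)\<^sup>2 + B)"
    using l par anti by (intro add_mono mult_left_mono) auto
  also have "\<dots> = A * (norm (a - b))\<^sup>2 + B"
    unfolding l(3) by (simp add: algebra_simps)
  finally show ?thesis
    unfolding p_flux_diff_inner A_def B_def s_t_def .
qed

text \<open>Both sides are affine in |a-b|^2 once the two lengths are fixed, so the extremes
  suffice: the tangent bound for parallel vectors, and subadditivity with exponent p - 1 in (0,1]
  for antiparallel ones.\<close>

lemma p_flux_monotone_le_2:
  assumes "1 < p" "p \<le> 2"
  shows "(p - 1) * ((norm (a - b))\<^sup>2 * (norm a + norm b) powr (p - 2))
    \<le> (p_flux p a - p_flux p b) \<bullet> (a - b)"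
proof -
  define s t where "s = norm a" "t = norm b"
  have st: "0 \<le> s" "0 \<le> t" by (auto simp: s_t_def)
  define A B where "A = (s powr (p - 2) + t powr (p - 2)) / 2"
    and "B = (s powr (p - 2) - t powr (p - 2)) / 2 * (s\<^sup>2 - t\<^sup>2)"
  define K where "K = (p - 1) * (s + t) powr (p - 2)"
  obtain l where l: "0 \<le> l" "l \<le> 1" "(norm (a - b))\<^sup>2 = (1 - l) * (s - t)\<^sup>2 + l * (s + t)\<^sup>2"
    unfolding s_t_def by (rule norm_diff_square_between)
  have par: "K * (s - t)\<^sup>2 \<le> A * (s - t)\<^sup>2 + B"
  proof -
    have gen: "(p - 1) * (s + t) powr (p - 2) * (s - t)\<^sup>2 \<le> (s powr (p - 1) - t powr (p - 1)) * (s - t)"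
      if "0 \<le> t" "t \<le> s" for s t
    proof -
      have "(p - 1) * (s - t) * (s + t) powr (p - 2) * (s - t) \<le> (s powr (p - 1) - t powr (p - 1)) * (s - t)"
        using powr_diff_ge_tangent[of "p - 1" t s] that assms by (intro mult_right_mono) (auto simp: algebra_simps)
      then show ?thesis
        by (simp add: power2_eq_square mult_ac)
    qed
    have "K * (s - t)\<^sup>2 \<le> (s powr (p - 1) - t powr (p - 1)) * (s - t)"
    proof (cases "t \<le> s")
      case False
      then have "(p - 1) * (t + s) powr (p - 2) * (t - s)\<^sup>2 \<le> (t powr (p - 1) - s powr (p - 1)) * (t - s)"
        using gen[of s t] st by simp
      then show ?thesis
        unfolding K_def by (simp add: power2_commute[of t s] add.commute[of t s] algebra_simps)
    qed (use gen[of t s] st in \<open>simp add: K_def\<close>)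
    then show ?thesis
      unfolding A_def B_def p_flux_endpoints(1)[OF st] .
  qed
  have anti: "K * (s + t)\<^sup>2 \<le> A * (s + t)\<^sup>2 + B"
  proof -
    have "(p - 1) * (s + t) powr (p - 1) \<le> 1 * (s + t) powr (p - 1)"
      using assms by (intro mult_right_mono) auto
    also have "\<dots> \<le> s powr (p - 1) + t powr (p - 1)"
      using powr_subadditive[of "p - 1" s t] st assms by simp
    finally have "(p - 1) * (s + t) powr (p - 1) * (s + t) \<le> (s powr (p - 1) + t powr (p - 1)) * (s + t)"
      using st by (intro mult_right_mono) auto
    then show ?thesis
      unfolding A_def B_def p_flux_endpoints(2)[OF st] K_def
      using st powr_eq_mult_powr_minus_one[of "s + t" "p - 1"] by (simp add: power2_eq_square mult_ac)
  qed
  have "K * (norm (a - b))\<^sup>2 = (1 - l) * (K * (s - t)\<^sup>2) + l * (K * (s + t)\<^sup>2)"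
    unfolding l(3) by (simp add: algebra_simps)
  also have "\<dots> \<le> (1 - l) * (A * (s - t)\<^sup>2 + B) + l * (A * (s + t)\<^sup>2 + B)"
    using l par anti by (intro add_mono mult_left_mono) auto
  also have "\<dots> = A * (norm (a - b))\<^sup>2 + B"
    unfolding l(3) by (simp add: algebra_simps)
  finally show ?thesis
    unfolding p_flux_diff_inner A_def B_def K_def s_t_def by (simp add: mult_ac)
qed

subsection \<open>Smooth bump functions\<close>

lemma Ck_Suc_D: "Ck (Suc k) f \<Longrightarrow> Ck k f"
proof (induction k arbitrary: f)
  case 0
  then show ?case
    by (auto simp: continuous_on_eq_continuous_within differentiable_imp_continuous_within)
next
  case (Suc k)
  then show ?case by auto
qed

lemma Ck_const: "Ck k (\<lambda>_. c)"
  by (induction k arbitrary: c) auto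

lemma Ck_add: "Ck k f \<Longrightarrow> Ck k g \<Longrightarrow> Ck k (\<lambda>x. f x + g x)"
proof (induction k arbitrary: f g)
  case 0
  then show ?case by (auto intro: continuous_on_add)
next
  case (Suc k)
  have "frechet_derivative (\<lambda>x. f x + g x) (at x) =
      (\<lambda>b. frechet_derivative f (at x) b + frechet_derivative g (at x) b)" for x
    using Suc.prems by (intro frechet_derivative_at[symmetric] has_derivative_add)
      (auto simp: frechet_derivative_works[symmetric])
  with Suc show ?case by auto
qed

lemma frechet_derivative_mult_real:
  fixes f g :: "'a::euclidean_space \<Rightarrow> real"
  assumes "f differentiable (at x)" "g differentiable (at x)"
  shows "frechet_derivative (\<lambda>x. f x * g x) (at x) =
    (\<lambda>b. f x * frechet_derivative g (at x) b + frechet_derivative f (at x) b * g x)"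
  using assms by (intro frechet_derivative_at[symmetric] has_derivative_mult)
    (auto simp: frechet_derivative_works[symmetric])

text \<open>The product rule leaves one factor undifferentiated in each term, so the induction needs
  f and g themselves to be of class k; this is what \<open>Ck_Suc_D\<close> supplies.\<close>

lemma Ck_mult: "Ck k f \<Longrightarrow> Ck k g \<Longrightarrow> Ck k (\<lambda>x. f x * g x)"
proof (induction k arbitrary: f g)
  case 0
  then show ?case by (auto intro: continuous_on_mult)
next
  case (Suc k)
  have d: "f differentiable (at x)" "g differentiable (at x)" for x
    using Suc.prems by auto
  have "Ck k f" "Ck k g"
    using Suc.prems Ck_Suc_D by blast+
  then show ?case
    using Suc by (auto simp: frechet_derivative_mult_real[OF d] intro!: Ck_add)
qed

lemma smooth_mult: "smooth f \<Longrightarrow> smooth g \<Longrightarrow> smooth (\<lambda>x. f x * g x)"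
  by (simp add: smooth_def Ck_mult)

lemma smooth_prod: "(\<And>i. i \<in> I \<Longrightarrow> smooth (f i)) \<Longrightarrow> smooth (\<lambda>x. \<Prod>i\<in>I. f i x)"
proof (induction I rule: infinite_finite_induct)
  case (insert i I)
  then show ?case by (simp add: smooth_mult)
qed (simp_all add: smooth_def Ck_const)

text \<open>The class of functions \<open>P(1/t) exp(-1/t)\<close>, extended by \<open>0\<close> to \<open>t \<le> 0\<close>, is closed under
  differentiation.\<close>

definition flat_exp :: "real poly \<Rightarrow> real \<Rightarrow> real" where
  "flat_exp P t = (if 0 < t then poly P (inverse t) * exp (- inverse t) else 0)"

lemma poly_times_exp_neg_tendsto_0: "((\<lambda>y::real. poly P y * exp (- y)) \<longlongrightarrow> 0) at_top"
proof -
  have "((\<lambda>y. \<Sum>i\<le>degree P. coeff P i * (y ^ i / exp y)) \<longlongrightarrow> (\<Sum>i\<le>degree P. coeff P i * 0)) at_top"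
    by (intro tendsto_intros tendsto_power_div_exp_0)
  then show ?thesis
    by (simp add: poly_altdef sum_distrib_right exp_minus divide_inverse mult.assoc)
qed

lemma flat_exp_tendsto_0: "(flat_exp P \<longlongrightarrow> 0) (at 0)"
proof (rule filterlim_split_at)
  have "\<forall>\<^sub>F t in at_left 0. 0 = flat_exp P t"
    by (simp add: eventually_at_filter flat_exp_def)
  then show "(flat_exp P \<longlongrightarrow> 0) (at_left 0)"
    using tendsto_cong by fastforce
  have "((\<lambda>t. poly P (inverse t) * exp (- inverse t)) \<longlongrightarrow> 0) (at_right 0)"
    by (rule filterlim_compose[OF poly_times_exp_neg_tendsto_0 filterlim_inverse_at_top_right])
  moreover have "\<forall>\<^sub>F t in at_right 0. poly P (inverse t) * exp (- inverse t) = flat_exp P t"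
    by (simp add: eventually_at_filter flat_exp_def)
  ultimately show "(flat_exp P \<longlongrightarrow> 0) (at_right 0)"
    using Lim_transform_eventually by blast
qed

text \<open>For t > 0 the derivative of P(1/t) exp(-1/t) is t^(-2) (P - P')(1/t) exp(-1/t), and
  t^(-2) is the polynomial \<open>[:0, 0, 1:]\<close> evaluated at 1/t.\<close>

lemma DERIV_flat_exp: "(flat_exp P has_real_derivative flat_exp ([:0, 0, 1:] * (P - pderiv P)) t) (at t)"
proof -
  consider "t < 0" | "t = 0" | "t > 0" by linarith
  then show ?thesis
  proof cases
    case 1
    then have "\<forall>\<^sub>F s in nhds t. flat_exp P s = 0"
      by (auto simp: flat_exp_def eventually_nhds intro!: exI[of _ "{..<0}"])
    then show ?thesis
      using 1 DERIV_cong_ev[OF refl _ refl, of "flat_exp P" "\<lambda>_. 0" t 0] by (simp add: flat_exp_def)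
  next
    case 2
    \<comment> \<open>The difference quotient at 0 stays in the class: division by h multiplies
      P(1/h) by 1/h. At h = 0 both sides are 0 by the convention for division.\<close>
    have "flat_exp (pCons 0 P) = (\<lambda>h. (flat_exp P (0 + h) - flat_exp P 0) / h)"
      by (auto simp: flat_exp_def field_simps)
    then show ?thesis
      using flat_exp_tendsto_0[of "pCons 0 P"] 2 by (simp add: DERIV_def flat_exp_def)
  next
    case 3
    then have ev: "\<forall>\<^sub>F s in nhds t. flat_exp P s = poly P (inverse s) * exp (- inverse s)"
      by (auto simp: flat_exp_def eventually_nhds intro!: exI[of _ "{0<..}"])
    have "((\<lambda>s. poly P (inverse s) * exp (- inverse s)) has_real_derivative
        flat_exp ([:0, 0, 1:] * (P - pderiv P)) t) (at t)"
    proof (rule DERIV_cong)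
      have inv: "(inverse has_real_derivative - (inverse t)\<^sup>2) (at t)"
        using 3 DERIV_inverse[of t UNIV] by (simp add: power2_eq_square)
      show "((\<lambda>s. poly P (inverse s) * exp (- inverse s)) has_real_derivative
          poly (pderiv P) (inverse t) * (- (inverse t)\<^sup>2) * exp (- inverse t)
          + exp (- inverse t) * (- (- (inverse t)\<^sup>2)) * poly P (inverse t)) (at t)"
        by (intro DERIV_mult DERIV_chain2[OF poly_DERIV inv] DERIV_chain2[OF DERIV_exp DERIV_minus[OF inv]])
    qed (use 3 in \<open>simp add: flat_exp_def power2_eq_square algebra_simps\<close>)
    then show ?thesis
      using DERIV_cong_ev[OF refl ev refl] by blast
  qed
qed

lemma has_derivative_flat_exp_affine:
  "((\<lambda>x. flat_exp P (c \<bullet> x + d)) has_derivative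
    (\<lambda>y. (c \<bullet> y) * flat_exp ([:0, 0, 1:] * (P - pderiv P)) (c \<bullet> x + d))) (at x)"
proof (rule DERIV_compose_FDERIV[OF DERIV_flat_exp])
  show "((\<lambda>x. c \<bullet> x + d) has_derivative (\<bullet>) c) (at x)"
    by (auto intro!: derivative_eq_intros)
qed

text \<open>The induction runs over all polynomials P at once, since each differentiation replaces P
  by another polynomial and contributes only a constant factor.\<close>

lemma Ck_flat_exp_affine: "Ck k (\<lambda>x. flat_exp P (c \<bullet> x + d))"
proof (induction k arbitrary: P)
  case 0
  have "isCont (\<lambda>x. flat_exp P (c \<bullet> x + d)) x" for x
    by (rule has_derivative_continuous[OF has_derivative_flat_exp_affine])
  then show ?case
    by (simp add: continuous_at_imp_continuous_on)
next
  case (Suc k)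
  define Q where "Q = [:0, 0, 1:] * (P - pderiv P)"
  have D: "((\<lambda>x. flat_exp P (c \<bullet> x + d)) has_derivative
      (\<lambda>y. (c \<bullet> y) * flat_exp Q (c \<bullet> x + d))) (at x)" for x
    unfolding Q_def by (rule has_derivative_flat_exp_affine)
  then have "(\<lambda>x. flat_exp P (c \<bullet> x + d)) differentiable (at x)" for x
    unfolding differentiable_def by blast
  moreover have "frechet_derivative (\<lambda>x. flat_exp P (c \<bullet> x + d)) (at x) =
      (\<lambda>y. (c \<bullet> y) * flat_exp Q (c \<bullet> x + d))" for x
    using frechet_derivative_at[OF D] by (rule sym)
  moreover have "Ck k (\<lambda>x. (c \<bullet> b) * flat_exp Q (c \<bullet> x + d))" for b
    by (rule Ck_mult[OF Ck_const Suc])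
  ultimately show ?case by simp
qed

text \<open>A factor is exp(-1/((n+1) t)) when the distance t to the corresponding face is positive,
  and 0 otherwise. Increasing n pushes it to 1, so the bumps approximate the indicator of the open
  box while staying supported in its closure.\<close>

definition box_bump :: "'a::euclidean_space \<Rightarrow> 'a \<Rightarrow> nat \<Rightarrow> 'a \<Rightarrow> real" where
  "box_bump a b n x = (\<Prod>i\<in>Basis. flat_exp 1 (real (Suc n) * (x \<bullet> i - a \<bullet> i))
     * flat_exp 1 (real (Suc n) * (b \<bullet> i - x \<bullet> i)))"

lemma smooth_box_bump: "smooth (box_bump a b n)"
proof -
  have "smooth (\<lambda>x. flat_exp 1 ((real (Suc n) *\<^sub>R i) \<bullet> x + - real (Suc n) * (a \<bullet> i))
     * flat_exp 1 ((- real (Suc n) *\<^sub>R i) \<bullet> x + real (Suc n) * (b \<bullet> i)))" for i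
    unfolding smooth_def by (intro allI Ck_mult Ck_flat_exp_affine)
  then show ?thesis
    unfolding box_bump_def
    by (intro smooth_prod) (simp add: algebra_simps inner_commute)
qed

lemma box_bump_eq_0_iff: "box_bump a b n x = 0 \<longleftrightarrow> x \<notin> box a b"
proof -
  have "flat_exp 1 (real (Suc n) * t) = 0 \<longleftrightarrow> \<not> 0 < t" for t
    by (simp add: flat_exp_def zero_less_mult_iff del: of_nat_Suc)
  then show ?thesis
    by (auto simp: box_bump_def mem_box simp del: of_nat_Suc)
qed

lemma box_bump_range: "0 \<le> box_bump a b n x" "box_bump a b n x \<le> 1"
proof -
  have "0 \<le> flat_exp 1 t" "flat_exp 1 t \<le> 1" for t
    by (auto simp: flat_exp_def)
  then show "0 \<le> box_bump a b n x" "box_bump a b n x \<le> 1"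
    unfolding box_bump_def by (auto intro!: prod_nonneg prod_le_1 mult_le_one)
qed

lemma box_bump_tendsto: "(\<lambda>n. box_bump a b n x) \<longlonglongrightarrow> indicator (box a b) x"
proof (cases "x \<in> box a b")
  case True
  have lim: "(\<lambda>n. flat_exp 1 (real (Suc n) * t)) \<longlonglongrightarrow> 1" if "t > 0" for t
  proof -
    have "(\<lambda>n. exp (- (inverse (real (Suc n)) * inverse t))) \<longlonglongrightarrow> exp (- (0 * inverse t))"
      by (intro tendsto_intros LIMSEQ_inverse_real_of_nat)
    then show ?thesis using that by (simp add: flat_exp_def)
  qed
  have "(\<lambda>n. box_bump a b n x) \<longlonglongrightarrow> (\<Prod>i\<in>(Basis :: 'a set). 1 * 1)"
    unfolding box_bump_def using True by (intro tendsto_prod tendsto_mult lim) (auto simp: mem_box)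
  then show ?thesis using True by simp
next
  case False
  then have "box_bump a b n x = 0" for n by (simp add: box_bump_eq_0_iff)
  then show ?thesis using False by simp
qed

lemma box_bump_test_function:
  assumes "cbox a b \<subseteq> \<Omega>"
  shows "box_bump a b n \<in> test_functions \<Omega>"
proof -
  have "closure {x. box_bump a b n x \<noteq> 0} \<subseteq> cbox a b"
    unfolding box_bump_eq_0_iff using closure_minimal[OF box_subset_cbox closed_cbox] by simp
  moreover from this have "compact (closure {x. box_bump a b n x \<noteq> 0})"
    using bounded_subset[OF bounded_cbox] by (simp add: compact_eq_bounded_closed)
  ultimately show ?thesis
    using assms smooth_box_bump by (auto simp: test_functions_def)
qed

section \<open>Gradients and supports of test functions\<close>

lemma grad_inner:
  assumes "i \<in> Basis"
  shows "grad f x \<bullet> i = frechet_derivative f (at x) i"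
  using assms by (simp add: grad_def)

lemma grad_mult:
  assumes "f differentiable (at x)" "g differentiable (at x)"
  shows "grad (\<lambda>x. f x * g x) x = f x *\<^sub>R grad g x + g x *\<^sub>R grad f x"
  unfolding grad_def frechet_derivative_mult_real[OF assms]
  by (simp add: scaleR_add_left sum.distrib scaleR_sum_right mult.commute)

lemma test_functions_differentiable: "\<phi> \<in> test_functions \<Omega> \<Longrightarrow> \<phi> differentiable (at x)"
proof -
  assume "\<phi> \<in> test_functions \<Omega>"
  then have "Ck (Suc 0) \<phi>"
    unfolding test_functions_def smooth_def by blast
  then show "\<phi> differentiable (at x)" by simp
qed

lemma test_functions_continuous:
  assumes "\<phi> \<in> test_functions \<Omega>"
  shows "continuous_on UNIV \<phi>" "continuous_on UNIV (grad \<phi>)"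
proof -
  have C: "Ck k \<phi>" for k
    using assms by (auto simp: test_functions_def smooth_def)
  show "continuous_on UNIV \<phi>"
    using C[of 0] by simp
  have "continuous_on UNIV (\<lambda>x. frechet_derivative \<phi> (at x) b)" if "b \<in> Basis" for b
    using C[of "Suc 0"] that by simp
  then show "continuous_on UNIV (grad \<phi>)"
    unfolding grad_def[abs_def] by (intro continuous_on_sum continuous_on_scaleR continuous_on_const)
qed

lemma test_functions_eq_0:
  assumes "x \<notin> closure {x. \<phi> x \<noteq> (0::real)}"
  shows "\<phi> x = 0" "grad \<phi> x = 0"
proof -
  define S where "S = closure {x. \<phi> x \<noteq> 0}"
  have S: "closed S" "x \<in> - S" and off: "\<And>y. y \<in> - S \<Longrightarrow> \<phi> y = 0"
    using assms closure_subset[of "{x. \<phi> x \<noteq> 0}"] by (auto simp: S_def)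
  show "\<phi> x = 0"
    using off S by blast
  have "(\<phi> has_derivative (\<lambda>_. 0)) (at x)"
  proof (rule has_derivative_transform_within_open)
    show "((\<lambda>_. 0) has_derivative (\<lambda>_. 0)) (at x)" by simp
    show "open (- S)" using S by (simp add: open_Compl)
  qed (use S off in simp_all)
  then have "frechet_derivative \<phi> (at x) = (\<lambda>_. 0)"
    using frechet_derivative_at by metis
  then show "grad \<phi> x = 0"
    by (simp add: grad_def)
qed

lemma test_functions_mult:
  assumes "\<phi> \<in> test_functions \<Omega>" "\<psi> \<in> test_functions \<Omega>"
  shows "(\<lambda>x. \<phi> x * \<psi> x) \<in> test_functions \<Omega>"
proof -
  have sub: "closure {x. \<phi> x * \<psi> x \<noteq> 0} \<subseteq> closure {x. \<phi> x \<noteq> 0}"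
    by (intro closure_mono) auto
  then have "compact (closure {x. \<phi> x * \<psi> x \<noteq> 0})"
    using assms(1) bounded_subset unfolding test_functions_def compact_eq_bounded_closed by blast
  then show ?thesis
    using sub assms by (auto simp: test_functions_def smooth_mult)
qed

subsection \<open>The fundamental lemma of the calculus of variations\<close>

lemma AE_lebesgue_on_iff:
  "S \<in> sets lebesgue \<Longrightarrow> (AE x in lebesgue_on S. P x) \<longleftrightarrow> (AE x in lebesgue. x \<in> S \<longrightarrow> P x)"
  by (simp add: AE_restrict_space_iff)

lemma integrable_lebesgue_on_vanishing:
  fixes f :: "'a::euclidean_space \<Rightarrow> 'b::euclidean_space"
  assumes "S \<in> sets lebesgue" "\<And>x. x \<notin> S \<Longrightarrow> f x = 0"
  shows "integrable (lebesgue_on S) f \<longleftrightarrow> integrable lebesgue f"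
    "(LINT x|lebesgue_on S. f x) = (LINT x|lebesgue. f x)"
proof -
  have "(\<lambda>x. indicator S x *\<^sub>R f x) = f"
    using assms(2) by (auto simp: indicator_def)
  then show "integrable (lebesgue_on S) f \<longleftrightarrow> integrable lebesgue f"
    "(LINT x|lebesgue_on S. f x) = (LINT x|lebesgue. f x)"
    using assms(1) by (simp_all add: integrable_restrict_space integral_restrict_space)
qed

text \<open>A general bilinear \<open>h\<close> covers both kinds of integrand in the weak
  formulations, test function times f and f times gradient. On K the continuous factor is bounded,
  so the product is dominated by a multiple of f cut off to K.\<close>

lemma locally_integrable_bilinear_integrable:
  fixes f :: "'a::euclidean_space \<Rightarrow> 'b::euclidean_space" and g :: "'a \<Rightarrow> 'c::euclidean_space"
    and h :: "'b \<Rightarrow> 'c \<Rightarrow> 'd::euclidean_space"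
  assumes h: "bounded_bilinear h" and \<Omega>: "open \<Omega>" and f: "locally_integrable \<Omega> f"
    and g: "continuous_on UNIV g" "\<And>x. x \<notin> K \<Longrightarrow> g x = 0" and K: "compact K" "K \<subseteq> \<Omega>"
  shows "integrable (lebesgue_on \<Omega>) (\<lambda>x. h (f x) (g x))"
proof -
  interpret bounded_bilinear h by fact
  have fK: "integrable lebesgue (\<lambda>x. indicator K x *\<^sub>R f x)"
    using f K by (auto simp: locally_integrable_def set_integrable_def)
  have eq: "h (f x) (g x) = h (indicator K x *\<^sub>R f x) (g x)" for x
    using g(2)[of x] by (cases "x \<in> K") (auto simp: zero_left zero_right)
  obtain B where B: "\<And>x. x \<in> K \<Longrightarrow> norm (g x) \<le> B" "0 < B"
    using compact_continuous_image[OF continuous_on_subset[OF g(1)] K(1)]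
    by (metis bounded_pos compact_imp_bounded image_eqI top_greatest)
  obtain C where C: "\<And>x y. norm (h x y) \<le> norm x * norm y * C" "0 < C"
    using pos_bounded by blast
  have "integrable lebesgue (\<lambda>x. h (indicator K x *\<^sub>R f x) (g x))"
  proof (rule Bochner_Integration.integrable_bound)
    show "integrable lebesgue (\<lambda>x. norm (indicator K x *\<^sub>R f x) * (B * C))"
      using fK by (intro integrable_mult_left integrable_norm)
    have "continuous_on UNIV (\<lambda>z. h (fst z) (snd z))"
      by (intro continuous_on continuous_intros)
    moreover have "g \<in> borel_measurable lebesgue"
      using g(1) by (simp add: borel_measurable_continuous_onI measurable_completion)
    ultimately show "(\<lambda>x. h (indicator K x *\<^sub>R f x) (g x)) \<in> borel_measurable lebesgue"
      using borel_measurable_continuous_Pair fK by (metis (no_types) borel_measurable_integrable)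
    show "AE x in lebesgue. norm (h (indicator K x *\<^sub>R f x) (g x))
        \<le> norm (norm (indicator K x *\<^sub>R f x) * (B * C))"
    proof (intro AE_I2)
      fix x
      have "norm (h (indicator K x *\<^sub>R f x) (g x)) \<le> norm (indicator K x *\<^sub>R f x) * norm (g x) * C"
        by (rule C)
      also have "\<dots> \<le> norm (indicator K x *\<^sub>R f x) * B * C"
        using B C by (cases "x \<in> K") (auto intro!: mult_right_mono mult_left_mono)
      finally show "norm (h (indicator K x *\<^sub>R f x) (g x)) \<le> norm (norm (indicator K x *\<^sub>R f x) * (B * C))"
        using B(2) C(2) by (simp add: mult.assoc abs_mult)
    qed
  qed
  moreover have "h (f x) (g x) = 0" if "x \<notin> \<Omega>" for x
    using that K(2) g(2) zero_right by (metis subsetD)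
  ultimately show ?thesis
    using \<Omega> by (subst integrable_lebesgue_on_vanishing) (auto simp flip: eq)
qed

text \<open>Dynkin's argument: open boxes form an intersection-stable generator of the Borel sets,
  and sets with zero integral are closed under countable disjoint unions and, because the total
  integral is 0, under complements.\<close>

lemma integrable_lebesgue_borel_set_integrals_0:
  fixes F :: "'a::euclidean_space \<Rightarrow> real"
  assumes F: "integrable lebesgue F"
    and total: "(LINT x|lebesgue. F x) = 0"
    and box: "\<And>c d. (LINT x:box c d|lebesgue. F x) = 0"
    and A: "A \<in> sets borel"
  shows "(LINT x:A|lebesgue. F x) = 0"
proof -
  let ?G = "range (\<lambda>(a, b). box a b :: 'a set)"
  have A': "A \<in> sigma_sets UNIV ?G"
    using A by (subst (asm) borel_eq_box) simp
  have meas: "B \<in> sets lebesgue" if "B \<in> sigma_sets UNIV ?G" for B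
  proof -
    have "B \<in> sets borel" using that by (subst borel_eq_box) simp
    then show ?thesis by (simp add: sets_completionI_sets)
  qed
  have int: "set_integrable lebesgue B F" if "B \<in> sets lebesgue" for B
    using F that integrable_mult_indicator unfolding set_integrable_def by blast
  show ?thesis
  proof (rule sigma_sets_induct_disjoint[OF _ _ A'])
    show "Int_stable ?G"
      by (auto simp: Int_stable_def box_Int_box)
    show "(LINT x:B|lebesgue. F x) = 0" if "B \<in> ?G" for B
      using that box by auto
    show "(LINT x:UNIV - B|lebesgue. F x) = 0"
      if B: "B \<in> sigma_sets UNIV ?G" "(LINT x:B|lebesgue. F x) = 0" for B
    proof -
      have "(LINT x:UNIV|lebesgue. F x) = (LINT x:B \<union> (UNIV - B)|lebesgue. F x)" by simp
      also have "\<dots> = (LINT x:B|lebesgue. F x) + (LINT x:UNIV - B|lebesgue. F x)"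
        using meas[OF B(1)] by (intro set_integral_Un int) auto
      finally show ?thesis
        using total B(2) by (simp add: set_lebesgue_integral_def)
    qed
    show "(LINT x:(\<Union>i. B i)|lebesgue. F x) = 0"
      if B: "disjoint_family B" "range B \<subseteq> sigma_sets UNIV ?G" "\<And>i. (LINT x:B i|lebesgue. F x) = 0"
      for B :: "nat \<Rightarrow> 'a set"
    proof -
      have Bm: "B i \<in> sets lebesgue" for i
        using B(2) meas by blast
      then have "(\<Union>i. B i) \<in> sets lebesgue" by blast
      then show ?thesis
        using B(1,3) Bm by (subst lebesgue_integral_countable_add)
          (auto intro: int simp: disjoint_family_on_def)
    qed
  qed (auto simp: set_lebesgue_integral_def)
qed

text \<open>A Lebesgue set differs from a Borel set by a null set, so the integral vanishes over
  every Lebesgue set. Taking the sets where F > 0 and where -F > 0 then forces both to be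
  null.\<close>

lemma integrable_lebesgue_AE_0:
  fixes F :: "'a::euclidean_space \<Rightarrow> real"
  assumes F: "integrable lebesgue F"
    and borel: "\<And>A. A \<in> sets borel \<Longrightarrow> (LINT x:A|lebesgue. F x) = 0"
  shows "AE x in lebesgue. F x = 0"
proof -
  have [measurable]: "F \<in> borel_measurable lebesgue" using F by auto
  have leb: "(LINT x:A|lebesgue. F x) = 0" if A: "A \<in> sets lebesgue" for A
  proof -
    obtain S N N' where S: "A = S \<union> N" "N \<subseteq> N'" "N' \<in> null_sets lborel" "S \<in> sets lborel"
      using sets_completionE[OF A] by metis
    have N': "N' \<in> null_sets lebesgue"
      using S(3) by (rule null_sets_completionI)
    have [measurable]: "S \<in> sets lebesgue"
      using S(4) by (simp add: sets_completionI_sets)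
    have "(LINT x:A|lebesgue. F x) = (LINT x:S|lebesgue. F x)"
      unfolding set_lebesgue_integral_def
    proof (rule integral_cong_AE)
      show "AE x in lebesgue. indicat_real A x *\<^sub>R F x = indicat_real S x *\<^sub>R F x"
        using AE_not_in[OF N'] by eventually_elim (use S(1,2) in \<open>auto simp: indicator_def\<close>)
    qed (use A in measurable)
    then show ?thesis
      using borel S(4) by simp
  qed
  have pos: "AE x in lebesgue. \<not> 0 < s * F x" for s :: real
  proof -
    define A where "A = {x. 0 < s * F x}"
    have A: "A \<in> sets lebesgue"
    proof -
      have "{x \<in> space lebesgue. 0 < s * F x} \<in> sets lebesgue" by measurable
      then show ?thesis by (simp add: A_def)
    qed
    have "(LINT x|lebesgue. s * (indicator A x *\<^sub>R F x)) = 0"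
      using leb[OF A] by (simp add: set_lebesgue_integral_def)
    moreover have "integrable lebesgue (\<lambda>x. s * (indicator A x *\<^sub>R F x))"
      using F A by (intro integrable_mult_right integrable_mult_indicator)
    ultimately have "AE x in lebesgue. s * (indicator A x *\<^sub>R F x) = 0"
      by (subst (asm) integral_nonneg_eq_0_iff_AE) (auto simp: A_def indicator_def)
    then show ?thesis
      by eventually_elim (auto simp: A_def indicator_def)
  qed
  show ?thesis
    using pos[of 1] pos[of "-1"] by eventually_elim auto
qed

text \<open>Box bumps are test functions with values in [0,1] converging to the indicator of the
  open box. Dominated convergence applies with f cut off to the closed box as majorant.\<close>

lemma locally_integrable_box_integral_0:
  fixes f :: "'a::euclidean_space \<Rightarrow> real"
  assumes \<Omega>: "open \<Omega>" and f: "locally_integrable \<Omega> f"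
    and test: "\<And>\<phi>. \<phi> \<in> test_functions \<Omega> \<Longrightarrow> (LINT x|lebesgue_on \<Omega>. \<phi> x * f x) = 0"
    and sub: "cbox c d \<subseteq> \<Omega>"
  shows "(LINT x:box c d|lebesgue. f x) = 0"
proof -
  define F where "F = (\<lambda>x. indicator (cbox c d) x *\<^sub>R f x)"
  have F: "integrable lebesgue F"
    using f sub compact_cbox unfolding locally_integrable_def set_integrable_def F_def by blast
  have bump_F: "box_bump c d n x * f x = box_bump c d n x * F x" for n x
    using box_bump_eq_0_iff[of c d n x] box_subset_cbox[of c d] by (auto simp: F_def indicator_def)
  have ind_F: "indicator (box c d) x *\<^sub>R f x = indicator (box c d) x * F x" for x
    using box_subset_cbox[of c d] by (auto simp: F_def indicator_def)
  have "(LINT x|lebesgue. box_bump c d n x * F x) = (LINT x|lebesgue_on \<Omega>. box_bump c d n x * f x)" for n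
    using \<Omega> box_bump_eq_0_iff[of c d n] box_subset_cbox[of c d] sub
    unfolding bump_F by (subst integrable_lebesgue_on_vanishing(2)) auto
  then have zero: "(LINT x|lebesgue. box_bump c d n x * F x) = 0" for n
    using test[OF box_bump_test_function[OF sub]] by simp
  have "(\<lambda>n. LINT x|lebesgue. box_bump c d n x * F x) \<longlonglongrightarrow> (LINT x|lebesgue. indicator (box c d) x * F x)"
  proof (rule integral_dominated_convergence)
    show "integrable lebesgue (\<lambda>x. norm (F x))"
      using F by (rule integrable_norm)
    show "(\<lambda>x. indicator (box c d) x * F x) \<in> borel_measurable lebesgue"
      using F by (intro borel_measurable_times borel_measurable_indicator) auto
    have "continuous_on UNIV (box_bump c d n)" for n
      using smooth_box_bump[of c d n] Ck.simps(1) unfolding smooth_def by blast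
    then have "box_bump c d n \<in> borel_measurable lebesgue" for n
      by (simp add: borel_measurable_continuous_onI measurable_completion)
    then show "(\<lambda>x. box_bump c d n x * F x) \<in> borel_measurable lebesgue" for n
      using F by (intro borel_measurable_times) auto
    show "AE x in lebesgue. (\<lambda>n. box_bump c d n x * F x) \<longlonglongrightarrow> indicator (box c d) x * F x"
      by (intro AE_I2 tendsto_mult box_bump_tendsto tendsto_const)
    show "AE x in lebesgue. norm (box_bump c d n x * F x) \<le> norm (F x)" for n
      using box_bump_range[of c d n] by (intro AE_I2) (auto simp: abs_mult intro!: mult_left_le_one_le)
  qed
  then show ?thesis
    unfolding zero ind_F set_lebesgue_integral_def using LIMSEQ_unique tendsto_const by metis
qed

text \<open>Localisation: on a closed box inside \<open>\<Omega>\<close> the function is integrable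
  and its integrals over all open subboxes vanish, so it is 0 almost everywhere there. Countably
  many such boxes exhaust \<open>\<Omega>\<close>.\<close>

lemma fundamental_lemma_calculus_of_variations:
  fixes f :: "'a::euclidean_space \<Rightarrow> real"
  assumes \<Omega>: "open \<Omega>" and f: "locally_integrable \<Omega> f"
    and test: "\<And>\<phi>. \<phi> \<in> test_functions \<Omega> \<Longrightarrow> (LINT x|lebesgue_on \<Omega>. \<phi> x * f x) = 0"
  shows "AE x in lebesgue_on \<Omega>. f x = 0"
proof -
  have cbox: "AE x in lebesgue. x \<in> cbox a b \<longrightarrow> f x = 0" if ab: "cbox a b \<subseteq> \<Omega>" for a b
  proof -
    define F where "F = (\<lambda>x. indicator (box a b) x *\<^sub>R f x)"
    have "integrable lebesgue (\<lambda>x. indicator (box a b) x *\<^sub>R (indicator (cbox a b) x *\<^sub>R f x))"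
    proof (rule integrable_mult_indicator)
      show "integrable lebesgue (\<lambda>x. indicator (cbox a b) x *\<^sub>R f x)"
        using f ab compact_cbox unfolding locally_integrable_def set_integrable_def by blast
    qed auto
    moreover have "(\<lambda>x. indicator (box a b) x *\<^sub>R (indicator (cbox a b) x *\<^sub>R f x)) = F"
      using box_subset_cbox[of a b] by (intro ext) (auto simp: F_def indicator_def)
    ultimately have F: "integrable lebesgue F" by simp
    have box0: "(LINT x:box c d|lebesgue. F x) = 0" for c d
    proof -
      \<comment> \<open>Empty intersections are split off because only a nonempty open box has the
        closed box with the same corners as its closure; a degenerate closed box could lie outside
        \<open>cbox a b\<close>.\<close>
      have "box c d \<inter> box a b = {} \<or>
        (\<exists>c' d'. box c d \<inter> box a b = box c' d' \<and> cbox c' d' \<subseteq> cbox a b)"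
      proof (cases "box c d \<inter> box a b = {}")
        case False
        obtain c' d' where cd: "box c d \<inter> box a b = box c' d'"
          unfolding box_Int_box by blast
        then have "cbox c' d' = closure (box c' d')"
          using False by simp
        also have "\<dots> \<subseteq> cbox a b"
          using cd box_subset_cbox[of a b] by (intro closure_minimal) auto
        finally show ?thesis using cd by blast
      qed simp
      moreover have "(LINT x:box c d|lebesgue. F x) = (LINT x:box c d \<inter> box a b|lebesgue. f x)"
        unfolding set_lebesgue_integral_def F_def
        by (intro Bochner_Integration.integral_cong) (auto simp: indicator_def)
      ultimately show ?thesis
        using locally_integrable_box_integral_0[OF \<Omega> f test] ab
        by (auto simp: set_lebesgue_integral_def)
    qed
    have total: "(LINT x|lebesgue. F x) = 0"
      using locally_integrable_box_integral_0[OF \<Omega> f test ab]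
      unfolding set_lebesgue_integral_def F_def .
    have "AE x in lebesgue. F x = 0"
      by (rule integrable_lebesgue_AE_0[OF F integrable_lebesgue_borel_set_integrals_0[OF F total box0]])
    moreover have "AE x in lebesgue. x \<notin> cbox a b - box a b"
      using negligible_frontier_interval[of a b] by (intro AE_not_in) (simp add: negligible_iff_null_sets)
    ultimately show ?thesis
      by eventually_elim (auto simp: F_def)
  qed
  obtain D where D: "countable D" "D \<subseteq> Pow \<Omega>" "\<And>X. X \<in> D \<Longrightarrow> \<exists>a b. X = cbox a b" "\<Union>D = \<Omega>"
    using open_countable_Union_open_cbox[OF \<Omega>] by metis
  have "AE x in lebesgue. \<forall>X\<in>D. x \<in> X \<longrightarrow> f x = 0"
    unfolding AE_ball_countable[OF D(1)] using D(2,3) cbox by (metis PowD subsetD)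
  then have "AE x in lebesgue. x \<in> \<Omega> \<longrightarrow> f x = 0"
    by eventually_elim (use D(4) in blast)
  then show ?thesis
    using \<Omega> by (simp add: AE_lebesgue_on_iff)
qed

subsection \<open>Weak gradients and divergences\<close>

lemma locally_integrable_diff:
  "locally_integrable \<Omega> f \<Longrightarrow> locally_integrable \<Omega> g \<Longrightarrow> locally_integrable \<Omega> (\<lambda>x. f x - g x)"
  by (auto simp: locally_integrable_def intro: set_integral_diff(1))

lemma locally_integrable_inner:
  "locally_integrable \<Omega> f \<Longrightarrow> locally_integrable \<Omega> (\<lambda>x. f x \<bullet> c)"
  unfolding locally_integrable_def set_integrable_def
  using integrable_inner_left[of c] by (fastforce simp flip: inner_scaleR_left)

lemma integrable_imp_locally_integrable:
  assumes "open \<Omega>" "integrable (lebesgue_on \<Omega>) f"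
  shows "locally_integrable \<Omega> f"
proof -
  have "set_integrable lebesgue \<Omega> f"
    using assms by (simp add: set_integrable_def integrable_restrict_space)
  then show ?thesis
    unfolding locally_integrable_def
    by (meson compact_imp_closed lborelD_Collect lmeasurable_compact fmeasurableD set_integrable_subset)
qed

lemma test_function_support:
  assumes "\<phi> \<in> test_functions \<Omega>"
  obtains K where "compact K" "K \<subseteq> \<Omega>" "\<And>x. x \<notin> K \<Longrightarrow> \<phi> x = 0" "\<And>x. x \<notin> K \<Longrightarrow> grad \<phi> x = 0"
proof (rule that)
  show "compact (closure {x. \<phi> x \<noteq> 0})" "closure {x. \<phi> x \<noteq> 0} \<subseteq> \<Omega>"
    using assms unfolding test_functions_def by blast+
qed (rule test_functions_eq_0, assumption)+

lemma integrable_mult_test_function: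
  fixes f :: "'a::euclidean_space \<Rightarrow> 'b::euclidean_space"
  assumes "open \<Omega>" "locally_integrable \<Omega> f" "\<phi> \<in> test_functions \<Omega>"
  shows "integrable (lebesgue_on \<Omega>) (\<lambda>x. \<phi> x *\<^sub>R f x)"
proof -
  obtain K where "compact K" "K \<subseteq> \<Omega>" "\<And>x. x \<notin> K \<Longrightarrow> \<phi> x = 0"
    using test_function_support[OF assms(3)] by metis
  then show ?thesis
    by (intro locally_integrable_bilinear_integrable[OF bounded_bilinear.flip[OF bounded_bilinear_scaleR]
          assms(1,2) test_functions_continuous(1)[OF assms(3)]])
qed

lemma integrable_scaleR_grad:
  fixes f :: "'a::euclidean_space \<Rightarrow> real"
  assumes "open \<Omega>" "locally_integrable \<Omega> f" "\<phi> \<in> test_functions \<Omega>"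
  shows "integrable (lebesgue_on \<Omega>) (\<lambda>x. f x *\<^sub>R grad \<phi> x)"
proof -
  obtain K where "compact K" "K \<subseteq> \<Omega>" "\<And>x. x \<notin> K \<Longrightarrow> grad \<phi> x = 0"
    using test_function_support[OF assms(3)] by metis
  then show ?thesis
    by (intro locally_integrable_bilinear_integrable[OF bounded_bilinear_scaleR
          assms(1,2) test_functions_continuous(2)[OF assms(3)]])
qed

text \<open>Pairing the vector identity with each basis vector reduces it to the scalar fundamental
  lemma; finitely many exceptional null sets are then combined.\<close>

lemma is_weak_grad_unique:
  fixes u :: "'a::euclidean_space \<Rightarrow> real"
  assumes \<Omega>: "open \<Omega>" and g: "is_weak_grad \<Omega> u g" "is_weak_grad \<Omega> u g'"
  shows "AE x in lebesgue_on \<Omega>. g x = g' x"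
proof -
  have loc: "locally_integrable \<Omega> g" "locally_integrable \<Omega> g'"
    using g by (auto simp: is_weak_grad_def)
  have "AE x in lebesgue_on \<Omega>. (g x - g' x) \<bullet> b = 0" for b
  proof (rule fundamental_lemma_calculus_of_variations[OF \<Omega>])
    show "locally_integrable \<Omega> (\<lambda>x. (g x - g' x) \<bullet> b)"
      by (intro locally_integrable_inner locally_integrable_diff loc)
    fix \<phi> assume \<phi>: "\<phi> \<in> test_functions \<Omega>"
    have "(LINT x|lebesgue_on \<Omega>. \<phi> x *\<^sub>R (g x - g' x)) = 0"
      using g \<phi> integrable_mult_test_function[OF \<Omega> loc(1) \<phi>] integrable_mult_test_function[OF \<Omega> loc(2) \<phi>]
      by (simp add: is_weak_grad_def scaleR_diff_right)
    moreover have "integrable (lebesgue_on \<Omega>) (\<lambda>x. \<phi> x *\<^sub>R (g x - g' x))"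
      by (intro integrable_mult_test_function[OF \<Omega>] locally_integrable_diff loc \<phi>)
    ultimately show "(LINT x|lebesgue_on \<Omega>. \<phi> x * ((g x - g' x) \<bullet> b)) = 0"
      using integral_inner_left[of b "lebesgue_on \<Omega>" "\<lambda>x. \<phi> x *\<^sub>R (g x - g' x)"] by simp
  qed
  then have "AE x in lebesgue_on \<Omega>. \<forall>b\<in>Basis. (g x - g' x) \<bullet> b = 0"
    by (intro AE_finite_allI) auto
  then show ?thesis
    by eventually_elim (simp add: euclidean_eq_iff[where 'a='a] inner_diff_left)
qed

lemma is_weak_div_unique:
  fixes \<eta> :: "'a::euclidean_space \<Rightarrow> 'a"
  assumes \<Omega>: "open \<Omega>" and d: "is_weak_div \<Omega> \<eta> d" "is_weak_div \<Omega> \<eta> d'"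
  shows "AE x in lebesgue_on \<Omega>. d x = d' x"
proof -
  have loc: "locally_integrable \<Omega> d" "locally_integrable \<Omega> d'"
    using d by (auto simp: is_weak_div_def)
  have "AE x in lebesgue_on \<Omega>. d x - d' x = 0"
  proof (rule fundamental_lemma_calculus_of_variations[OF \<Omega> locally_integrable_diff[OF loc]])
    fix \<phi> assume \<phi>: "\<phi> \<in> test_functions \<Omega>"
    show "(LINT x|lebesgue_on \<Omega>. \<phi> x * (d x - d' x)) = 0"
      using d \<phi> integrable_mult_test_function[OF \<Omega> loc(1) \<phi>] integrable_mult_test_function[OF \<Omega> loc(2) \<phi>]
      by (simp add: is_weak_div_def right_diff_distrib mult.commute)
  qed
  then show ?thesis by eventually_elim simp
qed

lemma is_weak_grad_diff:
  fixes u v :: "'a::euclidean_space \<Rightarrow> real"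
  assumes \<Omega>: "open \<Omega>" and "is_weak_grad \<Omega> u g" "is_weak_grad \<Omega> v g'"
  shows "is_weak_grad \<Omega> (\<lambda>x. u x - v x) (\<lambda>x. g x - g' x)"
proof -
  have loc: "locally_integrable \<Omega> u" "locally_integrable \<Omega> v" "locally_integrable \<Omega> g" "locally_integrable \<Omega> g'"
    using assms by (auto simp: is_weak_grad_def)
  have "(LINT x|lebesgue_on \<Omega>. (u x - v x) *\<^sub>R grad \<phi> x) = - (LINT x|lebesgue_on \<Omega>. \<phi> x *\<^sub>R (g x - g' x))"
    if \<phi>: "\<phi> \<in> test_functions \<Omega>" for \<phi>
    using assms \<phi> integrable_mult_test_function[OF \<Omega> loc(3) \<phi>] integrable_mult_test_function[OF \<Omega> loc(4) \<phi>]
      integrable_scaleR_grad[OF \<Omega> loc(1) \<phi>] integrable_scaleR_grad[OF \<Omega> loc(2) \<phi>]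
    by (simp add: is_weak_grad_def scaleR_diff_right scaleR_diff_left)
  then show ?thesis
    using loc by (simp add: is_weak_grad_def locally_integrable_diff)
qed

section \<open>Weak gradients of constants and of test functions\<close>

lemma DERIV_test_function_line:
  fixes \<phi> :: "'a::euclidean_space \<Rightarrow> real"
  assumes \<phi>: "\<phi> \<in> test_functions \<Omega>" and i: "i \<in> Basis"
  shows "((\<lambda>t. \<phi> (x + t *\<^sub>R i)) has_real_derivative grad \<phi> (x + t *\<^sub>R i) \<bullet> i) (at t)"
proof -
  have "(\<phi> has_derivative frechet_derivative \<phi> (at (x + t *\<^sub>R i))) (at (x + t *\<^sub>R i))"
    using test_functions_differentiable[OF \<phi>] frechet_derivative_works by blast
  moreover have "((\<lambda>t. x + t *\<^sub>R i) has_derivative (\<lambda>s. s *\<^sub>R i)) (at t)"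
    by (auto intro!: derivative_eq_intros)
  ultimately have D: "((\<lambda>t. \<phi> (x + t *\<^sub>R i)) has_derivative
      (\<lambda>s. frechet_derivative \<phi> (at (x + t *\<^sub>R i)) (s *\<^sub>R i))) (at t)"
    using has_derivative_compose by blast
  have "linear (frechet_derivative \<phi> (at (x + t *\<^sub>R i)))"
    by (rule linear_frechet_derivative[OF test_functions_differentiable[OF \<phi>]])
  then have "frechet_derivative \<phi> (at (x + t *\<^sub>R i)) (s *\<^sub>R i) = (grad \<phi> (x + t *\<^sub>R i) \<bullet> i) * s" for s
    by (simp add: linear_cmul grad_inner[OF i])
  then show ?thesis
    using D by (simp add: has_field_derivative_def)
qed

text \<open>Difference quotients have integral \<open>0\<close> by translation invariance, and they converge
  dominatedly to the partial derivative.\<close>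

lemma integral_grad_test_function_0:
  fixes \<phi> :: "'a::euclidean_space \<Rightarrow> real"
  assumes \<Omega>: "open \<Omega>" and \<phi>: "\<phi> \<in> test_functions \<Omega>"
  shows "integrable (lebesgue_on \<Omega>) (grad \<phi>)" "(LINT x|lebesgue_on \<Omega>. grad \<phi> x) = 0"
proof -
  obtain K where K: "compact K" "K \<subseteq> \<Omega>" "\<And>x. x \<notin> K \<Longrightarrow> \<phi> x = 0" "\<And>x. x \<notin> K \<Longrightarrow> grad \<phi> x = 0"
    using test_function_support[OF \<phi>] by metis
  obtain R where R: "\<And>x. x \<in> K \<Longrightarrow> norm x \<le> R"
    using compact_imp_bounded[OF K(1)] bounded_iff by blast
  have cont: "continuous_on UNIV \<phi>" "continuous_on UNIV (grad \<phi>)"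
    using test_functions_continuous[OF \<phi>] by auto
  have [measurable]: "\<phi> \<in> borel_measurable borel" "grad \<phi> \<in> borel_measurable borel"
    using cont by (auto intro: borel_measurable_continuous_onI)
  obtain B where B: "\<And>x. norm (grad \<phi> x) \<le> B"
  proof -
    obtain B where "\<And>x. x \<in> K \<Longrightarrow> norm (grad \<phi> x) \<le> B" "0 < B"
      using compact_continuous_image[OF continuous_on_subset[OF cont(2)] K(1)]
      by (metis bounded_pos compact_imp_bounded image_eqI top_greatest)
    then have "norm (grad \<phi> x) \<le> B" for x
      using K(4)[of x] by (cases "x \<in> K") auto
    then show ?thesis using that by blast
  qed
  have B0: "0 \<le> B" using B norm_ge_zero order_trans by blast
  obtain B' where B': "\<And>x. norm (\<phi> x) \<le> B'"
  proof -
    obtain B where "\<And>x. x \<in> K \<Longrightarrow> norm (\<phi> x) \<le> B" "0 < B"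
      using compact_continuous_image[OF continuous_on_subset[OF cont(1)] K(1)]
      by (metis bounded_pos compact_imp_bounded image_eqI top_greatest)
    then have "norm (\<phi> x) \<le> B" for x
      using K(3)[of x] by (cases "x \<in> K") auto
    then show ?thesis using that by blast
  qed
  have B'0: "0 \<le> B'" using B' norm_ge_zero order_trans by blast
  have ball: "integrable lborel (\<lambda>x::'a. c * indicator (cball 0 r) x)" for c r :: real
    using emeasure_compact_finite[OF compact_cball] by (intro integrable_mult_right integrable_real_indicator) auto
  have int_\<phi>: "integrable lborel \<phi>"
    by (rule Bochner_Integration.integrable_bound[OF ball[of B' R]])
      (use B' R K(3) in \<open>auto simp: indicator_def abs_of_nonneg[OF B'0]\<close>)
  have int_g: "integrable lborel (grad \<phi>)"
    by (rule Bochner_Integration.integrable_bound[OF ball[of B R]])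
      (use B R K(4) in \<open>auto simp: indicator_def abs_of_nonneg[OF B0]\<close>)
  have comp: "(LINT x|lborel. grad \<phi> x) \<bullet> i = 0" if i: "i \<in> Basis" for i
  proof -
    define q where "q = (\<lambda>n x. (\<phi> (inverse (real (Suc n)) *\<^sub>R i + x) - \<phi> x) / inverse (real (Suc n)))"
    have "(LINT x|lborel. \<phi> (c + x)) = (LINT x|lborel. \<phi> x)" "integrable lborel (\<lambda>x. \<phi> (c + x))" for c
      using integral_distr[of "(+) c" lborel borel \<phi>] integrable_distr[of "(+) c" lborel borel \<phi>] int_\<phi>
      by (simp_all add: lborel_distr_plus)
    then have q0: "(LINT x|lborel. q n x) = 0" for n
      unfolding q_def using int_\<phi> by (simp del: of_nat_Suc)
    have "(\<lambda>n. LINT x|lborel. q n x) \<longlonglongrightarrow> (LINT x|lborel. grad \<phi> x \<bullet> i)"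
    proof (rule integral_dominated_convergence)
      \<comment> \<open>The radius is R + 1 since the shift is at most 1: outside this ball both
        terms of the difference quotient vanish. Inside it, the mean value theorem bounds the
        quotient by B.\<close>
      show "integrable lborel (\<lambda>x::'a. B * indicator (cball 0 (R + 1)) x)" by (rule ball)
      show "AE x in lborel. (\<lambda>n. q n x) \<longlonglongrightarrow> grad \<phi> x \<bullet> i"
      proof (intro AE_I2)
        fix x
        have "(\<lambda>h. (\<phi> (x + h *\<^sub>R i) - \<phi> x) / h) \<midarrow>0\<rightarrow> grad \<phi> x \<bullet> i"
          using DERIV_test_function_line[OF \<phi> i, of x 0] by (simp add: DERIV_def)
        then show "(\<lambda>n. q n x) \<longlonglongrightarrow> grad \<phi> x \<bullet> i"
          unfolding q_def LIMSEQ_SEQ_conv[symmetric]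
          using LIMSEQ_inverse_real_of_nat by (auto simp: add.commute)
      qed
      show "AE x in lborel. norm (q n x) \<le> B * indicator (cball 0 (R + 1)) x" for n
      proof (intro AE_I2)
        fix x
        define h where "h = inverse (real (Suc n))"
        have h: "0 < h" "h \<le> 1" unfolding h_def by (auto simp: field_simps)
        show "norm (q n x) \<le> B * indicator (cball 0 (R + 1)) x"
        proof (cases "x \<in> cball 0 (R + 1)")
          case True
          obtain z where z: "\<phi> (x + h *\<^sub>R i) - \<phi> (x + 0 *\<^sub>R i) = (h - 0) * (grad \<phi> (x + z *\<^sub>R i) \<bullet> i)"
            using MVT2[OF h(1) DERIV_test_function_line[OF \<phi> i, of x]] by blast
          have "norm (q n x) = \<bar>grad \<phi> (x + z *\<^sub>R i) \<bullet> i\<bar>"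
            using z h unfolding q_def h_def[symmetric] by (simp add: add.commute)
          also have "\<dots> \<le> B"
            using B[of "x + z *\<^sub>R i"] Basis_le_norm[OF i, of "grad \<phi> (x + z *\<^sub>R i)"] by linarith
          finally show ?thesis using True by simp
        next
          case False
          then have x: "norm x > R + 1" by simp
          have "norm (h *\<^sub>R i + x) \<ge> norm x - norm (h *\<^sub>R i)"
            by (metis add.commute norm_diff_ineq)
          then have "norm (h *\<^sub>R i + x) > R"
            using x h i by simp
          then have "\<phi> (h *\<^sub>R i + x) = 0" "\<phi> x = 0"
            using x R K(3) by force+
          then show ?thesis
            using B0 unfolding q_def h_def[symmetric] by simp
        qed
      qed
    qed (simp_all add: q_def)
    then have "(LINT x|lborel. grad \<phi> x \<bullet> i) = 0"
      unfolding q0 using LIMSEQ_unique tendsto_const by metis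
    then show ?thesis
      using int_g by simp
  qed
  then have zero: "(LINT x|lborel. grad \<phi> x) = 0"
    by (simp add: euclidean_eq_iff[where 'a='a])
  have off: "grad \<phi> x = 0" if "x \<notin> \<Omega>" for x
    using that K by blast
  show "integrable (lebesgue_on \<Omega>) (grad \<phi>)" "(LINT x|lebesgue_on \<Omega>. grad \<phi> x) = 0"
    using \<Omega> off int_g zero
    by (simp_all add: integrable_lebesgue_on_vanishing integrable_completion integral_completion)
qed

text \<open>Against a constant, the integration by parts formula says exactly that the gradient of a
  test function has integral 0. Boundedness of \<open>\<Omega>\<close> makes constants
  integrable.\<close>

lemma is_weak_grad_const:
  fixes \<Omega> :: "'a::euclidean_space set"
  assumes "open \<Omega>" "bounded \<Omega>"
  shows "is_weak_grad \<Omega> (\<lambda>_. c) (\<lambda>_. 0)"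
proof -
  interpret finite_measure "lebesgue_on \<Omega>"
    using assms by (intro finite_measure_lebesgue_on bounded_set_imp_lmeasurable) auto
  show ?thesis
    using assms integral_grad_test_function_0[OF assms(1)]
    by (auto simp: is_weak_grad_def intro!: integrable_imp_locally_integrable)
qed

text \<open>The product of two test functions is again a test function, so its gradient integrates
  to 0; the product rule turns this into integration by parts.\<close>

lemma is_weak_grad_test_function:
  fixes \<Omega> :: "'a::euclidean_space set"
  assumes \<Omega>: "open \<Omega>" and \<phi>: "\<phi> \<in> test_functions \<Omega>"
  shows "is_weak_grad \<Omega> \<phi> (grad \<phi>)"
proof -
  obtain K where K: "compact K" "K \<subseteq> \<Omega>" "\<And>x. x \<notin> K \<Longrightarrow> \<phi> x = 0" "\<And>x. x \<notin> K \<Longrightarrow> grad \<phi> x = 0"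
    using test_function_support[OF \<phi>] by metis
  have loc: "locally_integrable \<Omega> f" if "continuous_on UNIV f" for f :: "'a \<Rightarrow> 'b::euclidean_space"
    unfolding locally_integrable_def set_integrable_def
  proof (intro allI impI)
    fix K assume "compact K \<and> K \<subseteq> \<Omega>"
    then have "integrable lborel (\<lambda>x. indicat_real K x *\<^sub>R f x)"
      using that borel_integrable_compact continuous_on_subset by blast
    then show "integrable lebesgue (\<lambda>x. indicat_real K x *\<^sub>R f x)"
      by (subst integrable_completion) auto
  qed
  have l: "locally_integrable \<Omega> \<phi>" "locally_integrable \<Omega> (grad \<phi>)"
    using loc test_functions_continuous[OF \<phi>] by auto
  have "(LINT x|lebesgue_on \<Omega>. \<phi> x *\<^sub>R grad \<psi> x) = - (LINT x|lebesgue_on \<Omega>. \<psi> x *\<^sub>R grad \<phi> x)"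
    if \<psi>: "\<psi> \<in> test_functions \<Omega>" for \<psi>
  proof -
    have "(LINT x|lebesgue_on \<Omega>. \<phi> x *\<^sub>R grad \<psi> x) + (LINT x|lebesgue_on \<Omega>. \<psi> x *\<^sub>R grad \<phi> x)
        = (LINT x|lebesgue_on \<Omega>. \<phi> x *\<^sub>R grad \<psi> x + \<psi> x *\<^sub>R grad \<phi> x)"
      using integrable_mult_test_function[OF \<Omega> l(2) \<psi>] integrable_scaleR_grad[OF \<Omega> l(1) \<psi>] by simp
    also have "\<dots> = (LINT x|lebesgue_on \<Omega>. grad (\<lambda>x. \<phi> x * \<psi> x) x)"
      using test_functions_differentiable \<phi> \<psi> by (subst grad_mult) blast+
    also have "\<dots> = 0"
      by (rule integral_grad_test_function_0(2)[OF \<Omega> test_functions_mult[OF \<phi> \<psi>]])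
    finally show ?thesis by (simp add: eq_neg_iff_add_eq_0)
  qed
  then show ?thesis
    using l by (simp add: is_weak_grad_def)
qed

subsection \<open>Lebesgue norms and energy estimates\<close>

lemma LpD:
  assumes "f \<in> Lp q M"
  shows "f \<in> borel_measurable M" "integrable M (\<lambda>x. norm (f x) powr q)"
  using assms by (auto simp: Lp_def)

lemma Lp_norm_nonneg: "0 \<le> Lp_norm q M f"
  by (simp add: Lp_norm_def)

lemma Lp_norm_powr: "q > 0 \<Longrightarrow> Lp_norm q M f powr q = (LINT x|M. norm (f x) powr q)"
  by (simp add: Lp_norm_def powr_powr)

lemma Lp_norm_eq_0_iff:
  assumes "q > 0" "f \<in> Lp q M"
  shows "Lp_norm q M f = 0 \<longleftrightarrow> (AE x in M. f x = 0)"
  using LpD[OF assms(2)] assms(1) by (simp add: Lp_norm_def integral_nonneg_eq_0_iff_AE)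

lemma Lp_norm_cong_AE:
  assumes "f \<in> borel_measurable M" "g \<in> borel_measurable M" "AE x in M. f x = g x"
  shows "Lp_norm q M f = Lp_norm q M g"
proof -
  have "(LINT x|M. norm (f x) powr q) = (LINT x|M. norm (g x) powr q)"
    using assms by (intro integral_cong_AE) auto
  then show ?thesis by (simp add: Lp_norm_def)
qed

lemma Lp_diff:
  assumes "q \<ge> 1" "f \<in> Lp q M" "g \<in> Lp q M"
  shows "(\<lambda>x. f x - g x) \<in> Lp q M"
proof -
  note [measurable] = LpD(1)[OF assms(2)] LpD(1)[OF assms(3)]
  have "integrable M (\<lambda>x. norm (f x - g x) powr q)"
  proof (rule Bochner_Integration.integrable_bound)
    show "integrable M (\<lambda>x. 2 powr (q - 1) * (norm (f x) powr q + norm (g x) powr q))"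
      using LpD(2)[OF assms(2)] LpD(2)[OF assms(3)] by auto
    have "norm (f x - g x) powr q \<le> 2 powr (q - 1) * (norm (f x) powr q + norm (g x) powr q)" for x
    proof -
      have "norm (f x - g x) powr q \<le> (norm (f x) + norm (g x)) powr q"
        using assms(1) by (intro powr_mono2 norm_triangle_ineq4) auto
      also have "\<dots> \<le> 2 powr (q - 1) * (norm (f x) powr q + norm (g x) powr q)"
        using assms(1) by (intro powr_midpoint_le) auto
      finally show ?thesis .
    qed
    then show "AE x in M. norm (norm (f x - g x) powr q)
        \<le> norm (2 powr (q - 1) * (norm (f x) powr q + norm (g x) powr q))"
      by simp
  qed measurable
  then show ?thesis by (simp add: Lp_def)
qed

lemma (in finite_measure) Lp_imp_integrable:
  assumes "q \<ge> 1" "f \<in> Lp q M"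
  shows "integrable M f"
proof (rule Bochner_Integration.integrable_bound)
  show "integrable M (\<lambda>x. 1 + norm (f x) powr q)"
    using LpD(2)[OF assms(2)] by simp
  have "norm (f x) \<le> 1 + norm (f x) powr q" for x
  proof (cases "norm (f x) \<le> 1")
    case False
    then have "norm (f x) powr 1 \<le> norm (f x) powr q"
      using assms(1) by (intro powr_mono) auto
    then show ?thesis by simp
  qed (simp add: add_increasing2)
  then show "AE x in M. norm (f x) \<le> norm (1 + norm (f x) powr q)"
    by simp
qed (rule LpD(1)[OF assms(2)])

lemma (in finite_measure) Lp_const: "(\<lambda>_. c) \<in> Lp q M"
  by (simp add: Lp_def)

lemma conj_exp_facts:
  assumes "p > 1"
  shows "conj_exp p > 1" "1 / p + 1 / conj_exp p = 1" "(p - 1) * conj_exp p = p"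
  using assms by (auto simp: conj_exp_def field_simps)

text \<open>The integrand \<open>H\<close> is only required to be dominated by the product of norms,
  so that inner products and scalar products are both covered. Young's inequality is applied after
  normalising by the two norms; if one of these is 0, \<open>H\<close> vanishes almost
  everywhere.\<close>

lemma Holder_inequality:
  fixes H :: "'a \<Rightarrow> 'd::{banach, second_countable_topology}"
  assumes pq: "p > 1" "q > 1" "1 / p + 1 / q = 1"
    and f: "f \<in> Lp p M" and g: "g \<in> Lp q M"
    and H: "H \<in> borel_measurable M" "\<And>x. norm (H x) \<le> norm (f x) * norm (g x)"
  shows "integrable M H" "norm (LINT x|M. H x) \<le> Lp_norm p M f * Lp_norm q M g"
proof -
  have young: "norm (H x) \<le> norm (f x) powr p / p + norm (g x) powr q / q" for x
    using H(2)[of x] Youngs_inequality[OF pq, of "norm (f x)" "norm (g x)"] by simp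
  show int: "integrable M H"
  proof (rule Bochner_Integration.integrable_bound)
    show "integrable M (\<lambda>x. norm (f x) powr p / p + norm (g x) powr q / q)"
      using LpD(2)[OF f] LpD(2)[OF g] by auto
    show "AE x in M. norm (H x) \<le> norm (norm (f x) powr p / p + norm (g x) powr q / q)"
      by (intro AE_I2 order_trans[OF young]) simp
  qed (rule H(1))
  define A B where "A = Lp_norm p M f" "B = Lp_norm q M g"
  have "A \<ge> 0" "B \<ge> 0" by (simp_all add: A_B_def Lp_norm_nonneg)
  then consider "A = 0" | "B = 0" | "A > 0" "B > 0" by linarith
  then show "norm (LINT x|M. H x) \<le> Lp_norm p M f * Lp_norm q M g"
  proof cases
    case 1
    then have "AE x in M. f x = 0"
      using Lp_norm_eq_0_iff[OF _ f] pq by (simp add: A_B_def)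
    then have "AE x in M. H x = 0"
      by eventually_elim (use H(2) in \<open>metis norm_zero mult_zero_left norm_le_zero_iff\<close>)
    then show ?thesis
      by (simp add: integral_eq_zero_AE Lp_norm_nonneg)
  next
    case 2
    then have "AE x in M. g x = 0"
      using Lp_norm_eq_0_iff[OF _ g] pq by (simp add: A_B_def)
    then have "AE x in M. H x = 0"
      by eventually_elim (use H(2) in \<open>metis norm_zero mult_zero_right norm_le_zero_iff\<close>)
    then show ?thesis
      by (simp add: integral_eq_zero_AE Lp_norm_nonneg)
  next
    case 3
    have powr: "A powr p = (LINT x|M. norm (f x) powr p)" "B powr q = (LINT x|M. norm (g x) powr q)"
      using pq by (simp_all add: A_B_def Lp_norm_powr)
    have "norm (H x) / (A * B) \<le> norm (f x) powr p / (A powr p) / p + norm (g x) powr q / (B powr q) / q" for x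
    proof -
      have "norm (H x) / (A * B) \<le> (norm (f x) / A) * (norm (g x) / B)"
        using H(2)[of x] 3 by (simp add: divide_right_mono)
      also have "\<dots> \<le> (norm (f x) / A) powr p / p + (norm (g x) / B) powr q / q"
        using 3 by (intro Youngs_inequality[OF pq]) auto
      finally show ?thesis
        using 3 by (simp add: powr_divide)
    qed
    then have "(LINT x|M. norm (H x) / (A * B))
        \<le> (LINT x|M. norm (f x) powr p / (A powr p) / p + norm (g x) powr q / (B powr q) / q)"
      using int LpD(2)[OF f] LpD(2)[OF g] by (intro integral_mono) auto
    also have "\<dots> = 1 / p + 1 / q"
      using 3 LpD(2)[OF f] LpD(2)[OF g] by (simp add: powr[symmetric])
    finally have "(LINT x|M. norm (H x)) \<le> A * B"
      using 3 pq(3) by (simp add: pos_divide_le_eq)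
    then show ?thesis
      using integral_norm_bound[of M H] unfolding A_B_def by linarith
  qed
qed

lemma Holder_inner:
  fixes f g :: "'a \<Rightarrow> 'b::euclidean_space"
  assumes "p > 1" "f \<in> Lp (conj_exp p) M" "g \<in> Lp p M"
  shows "integrable M (\<lambda>x. f x \<bullet> g x)"
    "\<bar>LINT x|M. f x \<bullet> g x\<bar> \<le> Lp_norm (conj_exp p) M f * Lp_norm p M g"
  using Holder_inequality[OF conj_exp_facts(1) assms(1) _ assms(2,3), of "\<lambda>x. f x \<bullet> g x"]
    assms conj_exp_facts[OF assms(1)] LpD(1)[OF assms(2)] LpD(1)[OF assms(3)]
  by (auto simp: Cauchy_Schwarz_ineq2 add.commute)

lemma Holder_mult:
  fixes f g :: "'a \<Rightarrow> real"
  assumes "p > 1" "f \<in> Lp (conj_exp p) M" "g \<in> Lp p M"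
  shows "integrable M (\<lambda>x. f x * g x)"
    "\<bar>LINT x|M. f x * g x\<bar> \<le> Lp_norm (conj_exp p) M f * Lp_norm p M g"
  using Holder_inner[OF assms] by simp_all

section \<open>Energy estimates from monotonicity\<close>

lemma p_flux_Lp:
  assumes p: "p > 1" and f: "f \<in> Lp p M"
  shows "(\<lambda>x. p_flux p (f x)) \<in> Lp (conj_exp p) M"
proof -
  have "(\<lambda>x. p_flux p (f x)) \<in> borel_measurable M"
    unfolding p_flux_def using LpD(1)[OF f] by measurable
  moreover have "norm (p_flux p (f x)) powr conj_exp p = norm (f x) powr p" for x
    using conj_exp_facts(3)[OF p] by (simp add: norm_p_flux powr_powr)
  ultimately show ?thesis
    using LpD(2)[OF f] by (simp add: Lp_def)
qed

lemma p_flux_inner_self: "p_flux p a \<bullet> a = norm a powr p"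
proof -
  have "p_flux p a \<bullet> a = norm a powr (p - 2) * (norm a * norm a)"
    by (simp add: p_flux_def power2_norm_eq_inner[symmetric] power2_eq_square)
  also have "\<dots> = norm a powr p"
    using powr_eq_mult_powr_minus_one[of "norm a" p] powr_eq_mult_powr_minus_one[of "norm a" "p - 1"]
    by simp
  finally show ?thesis .
qed

text \<open>Integrating the pointwise bound gives 2^(2-p) N^p <= D N. Cancelling N and taking the
  root of order p - 1 yields the constant 2^((p-2)/(p-1)).\<close>

lemma p_flux_strong_monotone_ge_2:
  fixes a b :: "'a \<Rightarrow> 'b::euclidean_space"
  assumes p: "p \<ge> 2" and a: "a \<in> Lp p M" and b: "b \<in> Lp p M"
    and N: "N = Lp_norm p M (\<lambda>x. a x - b x)" "N > 0" and D: "D \<ge> 0"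
    and le: "(LINT x|M. (p_flux p (a x) - p_flux p (b x)) \<bullet> (a x - b x)) \<le> D * N"
  shows "N \<le> 2 powr ((p - 2) / (p - 1)) * D powr (1 / (p - 1))"
proof -
  have p1: "p > 1" using p by simp
  have ab: "(\<lambda>x. a x - b x) \<in> Lp p M"
    using p a b by (intro Lp_diff) auto
  have "2 powr (2 - p) * N powr p = (LINT x|M. 2 powr (2 - p) * norm (a x - b x) powr p)"
    using p LpD(2)[OF ab] by (simp add: N Lp_norm_powr)
  also have "\<dots> \<le> (LINT x|M. (p_flux p (a x) - p_flux p (b x)) \<bullet> (a x - b x))"
    using p1 LpD(2)[OF ab] p_flux_monotone_ge_2[OF p]
    by (intro integral_mono Holder_inner(1)[OF p1] Lp_diff p_flux_Lp a b ab)
      (auto simp: conj_exp_facts less_imp_le)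
  also note le
  finally have "2 powr (2 - p) * N powr (p - 1) \<le> D"
    using N(2) powr_eq_mult_powr_minus_one[of N p] by simp
  then have "2 powr (p - 2) * (2 powr (2 - p) * N powr (p - 1)) \<le> 2 powr (p - 2) * D"
    by (intro mult_left_mono) auto
  then have "N powr (p - 1) \<le> 2 powr (p - 2) * D"
    by (simp add: mult.assoc[symmetric] powr_add[symmetric])
  then have "(N powr (p - 1)) powr (1 / (p - 1)) \<le> (2 powr (p - 2) * D) powr (1 / (p - 1))"
    using p1 by (intro powr_mono2) auto
  then show ?thesis
    using p1 D N(2) by (simp add: powr_powr powr_mult)
qed

text \<open>With d = |a-b| and s = |a|+|b|, Hoelder's inequality with exponents 2/p and 2/(2-p)
  bounds N^2 by the integral I of d^2 s^(p-2) times the power (2-p)/p of the integral of s^p.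
  Monotonicity gives (p-1) I <= D N, and one factor N cancels.\<close>

lemma p_flux_strong_monotone_less_2:
  fixes a b :: "'a \<Rightarrow> 'b::euclidean_space"
  assumes p: "1 < p" "p < 2" and a: "a \<in> Lp p M" and b: "b \<in> Lp p M"
    and N: "N = Lp_norm p M (\<lambda>x. a x - b x)" "N > 0"
    and le: "(LINT x|M. (p_flux p (a x) - p_flux p (b x)) \<bullet> (a x - b x)) \<le> D * N"
    and A: "Lp_norm p M a powr p + Lp_norm p M b powr p \<le> A"
  shows "N \<le> inverse (p - 1) * 2 powr ((2 - p) / p) * A powr ((2 - p) / p) * D"
proof -
  define s d where "s = (\<lambda>x. norm (a x) + norm (b x))" "d = (\<lambda>x. norm (a x - b x))"
  note [measurable] = LpD(1)[OF a] LpD(1)[OF b]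
  have [measurable]: "s \<in> borel_measurable M" "d \<in> borel_measurable M"
    unfolding s_d_def by measurable
  have sd: "0 \<le> s x" "0 \<le> d x" "d x \<le> s x" for x
    by (auto simp: s_d_def norm_triangle_ineq4)
  have ab: "(\<lambda>x. a x - b x) \<in> Lp p M"
    using p a b by (intro Lp_diff) auto
  define E where "E = (\<lambda>x. (p_flux p (a x) - p_flux p (b x)) \<bullet> (a x - b x))"
  have intE: "integrable M E"
    unfolding E_def using p
    by (intro Holder_inner(1)[OF p(1)] Lp_diff p_flux_Lp a b) (auto simp: conj_exp_facts less_imp_le)
  have E: "(p - 1) * ((d x)\<^sup>2 * s x powr (p - 2)) \<le> E x" for x
    using p_flux_monotone_le_2[of p "a x" "b x"] p by (simp add: E_def s_d_def)
  have intI: "integrable M (\<lambda>x. (p - 1) * ((d x)\<^sup>2 * s x powr (p - 2)))"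
    by (rule Bochner_Integration.integrable_bound[OF intE])
      (use E p in \<open>auto simp: abs_mult intro: order_trans[OF _ abs_ge_self]\<close>)
  define I where "I = (LINT x|M. (d x)\<^sup>2 * s x powr (p - 2))"
  have I0: "0 \<le> I" by (simp add: I_def)
  have I: "(p - 1) * I \<le> D * N"
  proof -
    have "(p - 1) * I = (LINT x|M. (p - 1) * ((d x)\<^sup>2 * s x powr (p - 2)))"
      by (simp add: I_def)
    also have "\<dots> \<le> (LINT x|M. E x)"
      using E by (intro integral_mono intI intE)
    finally show ?thesis using le by (simp add: E_def)
  qed
  \<comment> \<open>The convexity constant 2^(p-1) is relaxed to 2; this 2 becomes the factor
    2^((2-p)/p) of the final estimate.\<close>
  have s_le: "s x powr p \<le> 2 * (norm (a x) powr p + norm (b x) powr p)" for x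
  proof -
    have "s x powr p \<le> 2 powr (p - 1) * (norm (a x) powr p + norm (b x) powr p)"
      using p unfolding s_d_def by (intro powr_midpoint_le) auto
    also have "\<dots> \<le> 2 * (norm (a x) powr p + norm (b x) powr p)"
      using p powr_mono[of "p - 1" 1 2] by (intro mult_right_mono) auto
    finally show ?thesis .
  qed
  have int_ab: "integrable M (\<lambda>x. 2 * (norm (a x) powr p + norm (b x) powr p))"
    using LpD(2)[OF a] LpD(2)[OF b] by simp
  have int_s: "integrable M (\<lambda>x. s x powr p)"
    by (rule Bochner_Integration.integrable_bound[OF int_ab])
      (use s_le in \<open>auto intro: order_trans[OF _ abs_ge_self]\<close>)
  have J: "(LINT x|M. s x powr p) \<le> 2 * A"
  proof -
    have "(LINT x|M. s x powr p) \<le> (LINT x|M. 2 * (norm (a x) powr p + norm (b x) powr p))"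
      using s_le by (intro integral_mono int_s int_ab)
    also have "\<dots> = 2 * (Lp_norm p M a powr p + Lp_norm p M b powr p)"
      using p LpD(2)[OF a] LpD(2)[OF b] by (simp add: Lp_norm_powr)
    finally show ?thesis using A by simp
  qed
  \<comment> \<open>The factor g compensates the weight s^(p-2) hidden in f: the product f g is d^p,
    while f^(2/p) = d^2 s^(p-2) and g^(2/(2-p)) = s^p.\<close>
  define f g where "f = (\<lambda>x. d x powr p * s x powr (p * (p - 2) / 2))"
    and "g = (\<lambda>x. s x powr (p * (2 - p) / 2))"
  have f_powr: "norm (f x) powr (2 / p) = (d x)\<^sup>2 * s x powr (p - 2)" for x
  proof -
    have "d x powr 2 = (d x)\<^sup>2"
      using sd(2)[of x] by (cases "d x = 0") auto
    then show ?thesis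
      using p by (simp add: f_def abs_mult powr_mult powr_powr)
  qed
  have g_powr: "norm (g x) powr (2 / (2 - p)) = s x powr p" for x
    using p by (simp add: g_def powr_powr)
  have fg: "f x * g x = d x powr p" for x
  \<comment> \<open>Where s = 0 the powers of s do not cancel, since \<open>powr\<close> returns 0
    there; but d <= s makes both sides 0.\<close>
  proof (cases "s x = 0")
    case True
    then have "d x = 0" using sd[of x] by simp
    then show ?thesis by (simp add: f_def)
  next
    case False
    have "p * (p - 2) / 2 + p * (2 - p) / 2 = 0" by (simp add: field_simps)
    then show ?thesis
      using False sd(1)[of x] by (simp add: f_def g_def mult.assoc powr_add[symmetric])
  qed
  have intI': "integrable M (\<lambda>x. (d x)\<^sup>2 * s x powr (p - 2))"
    using intI p by simp
  have "f \<in> borel_measurable M" "g \<in> borel_measurable M"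
    unfolding f_def g_def by measurable
  then have fL: "f \<in> Lp (2 / p) M" and gL: "g \<in> Lp (2 / (2 - p)) M"
    using int_s intI' by (auto simp only: Lp_def f_powr g_powr mem_Collect_eq)
  have "norm (LINT x|M. f x * g x) \<le> Lp_norm (2 / p) M f * Lp_norm (2 / (2 - p)) M g"
  proof (rule Holder_inequality(2)[OF _ _ _ fL gL])
    show "1 / (2 / p) + 1 / (2 / (2 - p)) = 1" using p by (simp add: field_simps)
    show "(\<lambda>x. f x * g x) \<in> borel_measurable M"
      unfolding fg by measurable
  qed (use p in \<open>auto simp: abs_mult\<close>)
  moreover have "N powr p = (LINT x|M. d x powr p)"
    using p by (simp add: N Lp_norm_powr s_d_def)
  ultimately have "N powr p \<le> I powr (p / 2) * (LINT x|M. s x powr p) powr ((2 - p) / 2)"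
    unfolding fg by (simp add: Lp_norm_def f_powr[simplified] g_powr[simplified] I_def)
  also have "\<dots> \<le> I powr (p / 2) * (2 * A) powr ((2 - p) / 2)"
    using J p by (intro mult_left_mono powr_mono2) auto
  finally have "(N powr p) powr (2 / p) \<le> (I powr (p / 2) * (2 * A) powr ((2 - p) / 2)) powr (2 / p)"
    using p by (intro powr_mono2) auto
  moreover have A0: "0 \<le> A"
    using A by (meson add_nonneg_nonneg order_trans powr_ge_zero)
  moreover have "(4 - p * 2) / (2 * p) = (2 - p) / p"
    using p by (simp add: field_simps)
  ultimately have "N\<^sup>2 \<le> I * (2 * A) powr ((2 - p) / p)"
    using N(2) p I0 by (simp add: powr_powr powr_mult)
  also have "\<dots> \<le> (D * N / (p - 1)) * (2 * A) powr ((2 - p) / p)"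
    using I p by (intro mult_right_mono) (auto simp: field_simps)
  finally have "N * N \<le> N * (inverse (p - 1) * (2 * A) powr ((2 - p) / p) * D)"
    by (simp add: power2_eq_square field_simps)
  then have "N \<le> inverse (p - 1) * (2 * A) powr ((2 - p) / p) * D"
    using N(2) by simp
  then show ?thesis
    using A0 by (simp add: powr_mult mult.assoc)
qed

subsection \<open>Sobolev functions and the dual majorant\<close>

text \<open>Completeness of Lebesgue measure carries measurability across almost everywhere
  equality. This transfers integrability from some weak gradient or divergence to the chosen
  one.\<close>

lemma Lp_lebesgue_on_cong_AE:
  fixes f g :: "'a::euclidean_space \<Rightarrow> 'b::euclidean_space"
  assumes S: "S \<in> sets lebesgue" and f: "f \<in> Lp q (lebesgue_on S)"
    and AE: "AE x in lebesgue_on S. f x = g x"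
  shows "g \<in> Lp q (lebesgue_on S)"
proof -
  have eq: "AE x in lebesgue. (if x \<in> S then f x else 0) = (if x \<in> S then g x else 0)"
    using AE unfolding AE_lebesgue_on_iff[OF S] by eventually_elim auto
  have "(\<lambda>x. if x \<in> S then f x else 0) \<in> borel_measurable lebesgue"
    using LpD(1)[OF f] by (simp only: borel_measurable_if[OF S])
  then have "(\<lambda>x. if x \<in> S then g x else 0) \<in> borel_measurable lebesgue"
    by (rule borel_measurable_AE[OF _ eq])
  then have g: "g \<in> borel_measurable (lebesgue_on S)"
    by (simp only: borel_measurable_if[OF S])
  have "integrable (lebesgue_on S) (\<lambda>x. norm (g x) powr q)"
  proof (rule integrable_cong_AE_imp[OF LpD(2)[OF f]])
    show "AE x in lebesgue_on S. norm (f x) powr q = norm (g x) powr q"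
      using AE by eventually_elim simp
  qed (use g in measurable)
  then show ?thesis
    using g by (simp add: Lp_def)
qed

section \<open>Calculus of Sobolev functions\<close>

lemma is_weak_grad_weak_grad: "is_weak_grad \<Omega> u g \<Longrightarrow> is_weak_grad \<Omega> u (weak_grad \<Omega> u)"
  unfolding weak_grad_def by (rule someI[where P = "is_weak_grad \<Omega> u"])

lemma is_weak_div_weak_div: "is_weak_div \<Omega> \<eta> d \<Longrightarrow> is_weak_div \<Omega> \<eta> (weak_div \<Omega> \<eta>)"
  unfolding weak_div_def by (rule someI[where P = "is_weak_div \<Omega> \<eta>"])

lemma weak_grad_AE_eq:
  assumes "open \<Omega>" "is_weak_grad \<Omega> u g"
  shows "AE x in lebesgue_on \<Omega>. weak_grad \<Omega> u x = g x"
  by (rule is_weak_grad_unique[OF assms(1) is_weak_grad_weak_grad[OF assms(2)] assms(2)])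

lemma W1pD:
  fixes \<Omega> :: "'a::euclidean_space set"
  assumes "open \<Omega>" "u \<in> W1p p \<Omega>"
  shows "u \<in> Lp p (lebesgue_on \<Omega>)" "is_weak_grad \<Omega> u (weak_grad \<Omega> u)"
    "weak_grad \<Omega> u \<in> Lp p (lebesgue_on \<Omega>)"
proof -
  obtain g where g: "g \<in> Lp p (lebesgue_on \<Omega>)" "is_weak_grad \<Omega> u g"
    using assms by (auto simp: W1p_def)
  show "u \<in> Lp p (lebesgue_on \<Omega>)" using assms by (simp add: W1p_def)
  show w: "is_weak_grad \<Omega> u (weak_grad \<Omega> u)"
    by (rule is_weak_grad_weak_grad[OF g(2)])
  show "weak_grad \<Omega> u \<in> Lp p (lebesgue_on \<Omega>)"
    using assms(1) by (intro Lp_lebesgue_on_cong_AE[OF _ g(1)] is_weak_grad_unique[OF _ g(2) w]) auto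
qed

lemma W1p_diff:
  fixes \<Omega> :: "'a::euclidean_space set"
  assumes "open \<Omega>" "p \<ge> 1" "u \<in> W1p p \<Omega>" "v \<in> W1p p \<Omega>"
  shows "(\<lambda>x. u x - v x) \<in> W1p p \<Omega>"
    "AE x in lebesgue_on \<Omega>. weak_grad \<Omega> (\<lambda>x. u x - v x) x = weak_grad \<Omega> u x - weak_grad \<Omega> v x"
proof -
  note u = W1pD[OF assms(1,3)] and v = W1pD[OF assms(1,4)]
  note d = is_weak_grad_diff[OF assms(1) u(2) v(2)]
  show "(\<lambda>x. u x - v x) \<in> W1p p \<Omega>"
    unfolding W1p_def using d Lp_diff[OF assms(2) u(1) v(1)] Lp_diff[OF assms(2) u(3) v(3)] by blast
  show "AE x in lebesgue_on \<Omega>. weak_grad \<Omega> (\<lambda>x. u x - v x) x = weak_grad \<Omega> u x - weak_grad \<Omega> v x"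
    by (rule weak_grad_AE_eq[OF assms(1) d])
qed

text \<open>The defining integrals see w only up to null sets, so the zero field is also a weak
  gradient. Contrapositively, a function with nonzero gradient is admissible as a nonzero competitor
  in the dual norm.\<close>

lemma weak_grad_AE_0:
  fixes \<Omega> :: "'a::euclidean_space set"
  assumes \<Omega>: "open \<Omega>" "bounded \<Omega>" and w: "is_weak_grad \<Omega> w g"
    and 0: "AE x in lebesgue_on \<Omega>. w x = 0"
  shows "AE x in lebesgue_on \<Omega>. weak_grad \<Omega> w x = 0"
proof -
  have "(LINT x|lebesgue_on \<Omega>. w x *\<^sub>R grad \<phi> x) = 0" for \<phi>
    using 0 by (intro integral_eq_zero_AE) auto
  moreover have "locally_integrable \<Omega> w" "locally_integrable \<Omega> (\<lambda>_. 0 :: 'a)"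
    using w is_weak_grad_const[OF \<Omega>, of 0] by (auto simp: is_weak_grad_def)
  ultimately have "is_weak_grad \<Omega> w (\<lambda>_. 0)"
    by (simp add: is_weak_grad_def)
  then show ?thesis
    by (rule weak_grad_AE_eq[OF \<Omega>(1)])
qed

lemma W1p_const:
  fixes \<Omega> :: "'a::euclidean_space set"
  assumes "open \<Omega>" "bounded \<Omega>"
  shows "(\<lambda>_. c) \<in> W1p p \<Omega>"
proof -
  interpret finite_measure "lebesgue_on \<Omega>"
    using assms by (intro finite_measure_lebesgue_on bounded_set_imp_lmeasurable) auto
  show ?thesis
    using Lp_const[of c p] Lp_const[of "0 :: 'a" p] is_weak_grad_const[OF assms, of c]
    unfolding W1p_def by auto
qed

lemma test_function_in_W1p:
  fixes \<Omega> :: "'a::euclidean_space set"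
  assumes \<Omega>: "open \<Omega>" "bounded \<Omega>" and p: "p > 0" and \<phi>: "\<phi> \<in> test_functions \<Omega>"
  shows "\<phi> \<in> W1p p \<Omega>"
proof -
  interpret finite_measure "lebesgue_on \<Omega>"
    using \<Omega> by (intro finite_measure_lebesgue_on bounded_set_imp_lmeasurable) auto
  have Lp: "f \<in> Lp p (lebesgue_on \<Omega>)" if f: "continuous_on UNIV f" for f :: "'a \<Rightarrow> 'b::euclidean_space"
  proof -
    have "f \<in> borel_measurable lebesgue"
      using f by (simp add: borel_measurable_continuous_onI measurable_completion)
    then have m: "f \<in> borel_measurable (lebesgue_on \<Omega>)"
      by (rule measurable_restrict_space1)
    have "compact (closure \<Omega>)"
      using \<Omega>(2) by (simp add: compact_closure)
    then have "bounded (f ` closure \<Omega>)"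
      using f by (intro compact_imp_bounded compact_continuous_image) (auto intro: continuous_on_subset)
    then obtain B where B: "\<And>x. x \<in> \<Omega> \<Longrightarrow> norm (f x) \<le> B"
      unfolding bounded_iff using closure_subset by blast
    have "integrable (lebesgue_on \<Omega>) (\<lambda>x. norm (f x) powr p)"
    proof (rule integrable_const_bound[where B = "B powr p"])
      show "AE x in lebesgue_on \<Omega>. norm (norm (f x) powr p) \<le> B powr p"
        using B p by (intro AE_I2) (auto intro!: powr_mono2)
    qed (use m in measurable)
    then show ?thesis using m by (simp add: Lp_def)
  qed
  show ?thesis
    unfolding W1p_def
    using Lp[OF test_functions_continuous(1)[OF \<phi>]] Lp[OF test_functions_continuous(2)[OF \<phi>]]
      is_weak_grad_test_function[OF \<Omega>(1) \<phi>] by auto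
qed

section \<open>Fields with normal trace and the dual majorant\<close>

lemma weak_div_Lp:
  fixes \<Omega> :: "'a::euclidean_space set"
  assumes \<Omega>: "open \<Omega>" and \<eta>: "\<eta> \<in> Q_nu p \<Omega>"
  shows "weak_div \<Omega> \<eta> \<in> Lp (conj_exp p) (lebesgue_on \<Omega>)"
proof -
  obtain d where d: "d \<in> Lp (conj_exp p) (lebesgue_on \<Omega>)" "is_weak_div \<Omega> \<eta> d"
    using \<eta> by (auto simp: Q_nu_def)
  show ?thesis
    using \<Omega> by (intro Lp_lebesgue_on_cong_AE[OF _ d(1)]
        is_weak_div_unique[OF _ d(2) is_weak_div_weak_div[OF d(2)]]) auto
qed

text \<open>If no trace exists, the default function 0 still lies in the space, so the bound covers
  that case as well.\<close>

lemma boundary_trace_Lp: "boundary_trace p \<Omega> w \<in> Lp p (surface_measure \<Omega>)"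
proof (cases "\<exists>t. is_trace p \<Omega> w t")
  case True
  then have "is_trace p \<Omega> w (SOME t. is_trace p \<Omega> w t)"
    by (rule someI_ex)
  then have "(SOME t. is_trace p \<Omega> w t) \<in> Lp p (surface_measure \<Omega>)"
    unfolding is_trace_def by (rule conjunct1)
  then show ?thesis
    using True by (simp add: boundary_trace_def)
qed (simp add: boundary_trace_def Lp_def)

text \<open>The zero field makes the infimum range over a nonempty set and furnishes a finite upper
  bound for the supremum in the dual norm. Its chosen divergence is 0 only almost everywhere, which
  suffices inside Green's formula.\<close>

lemma zero_in_Q_nu:
  fixes \<Omega> :: "'a::euclidean_space set"
  assumes \<Omega>: "open \<Omega>" "bounded \<Omega>"
  shows "(\<lambda>_. 0) \<in> Q_nu p \<Omega>"
proof -
  have "locally_integrable \<Omega> (\<lambda>_. 0 :: 'a)" "locally_integrable \<Omega> (\<lambda>_. 0 :: real)"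
    using is_weak_grad_const[OF \<Omega>, of 0] by (auto simp: is_weak_grad_def)
  then have d: "is_weak_div \<Omega> (\<lambda>_. 0) (\<lambda>_. 0)"
    by (simp add: is_weak_div_def)
  have "AE x in lebesgue_on \<Omega>. weak_div \<Omega> (\<lambda>_. 0) x = 0"
    by (rule is_weak_div_unique[OF \<Omega>(1) is_weak_div_weak_div[OF d] d])
  then have "(LINT x|lebesgue_on \<Omega>. weak_div \<Omega> (\<lambda>_. 0) x * \<xi> x) = 0" for \<xi> :: "'a \<Rightarrow> real"
    by (intro integral_eq_zero_AE) auto
  then have "is_normal_trace p \<Omega> (\<lambda>_. 0) (\<lambda>_. 0)"
    by (simp add: is_normal_trace_def Lp_def)
  then show ?thesis
    using d by (auto simp: Q_nu_def Lp_def intro!: exI[of _ "\<lambda>_. 0"] bexI[of _ "\<lambda>_. 0"])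
qed

text \<open>Green's formula for \<open>\<eta>\<close> is inserted as an added zero. This splits the
  functional into a flux, a divergence and a boundary pairing, and the Poincare and trace bounds
  express all three Hoelder estimates through the gradient of w.\<close>

lemma dF_le_majorant:
  fixes \<Omega> :: "'a::euclidean_space set"
  assumes p: "p > 1" and \<Omega>: "open \<Omega>" and h: "h \<in> Lp (conj_exp p) (lebesgue_on \<Omega>)"
    and v: "v \<in> W1p p \<Omega>" and w: "w \<in> W1p p \<Omega>" and \<eta>: "\<eta> \<in> Q_nu p \<Omega>"
    and poincare: "Lp_norm p (lebesgue_on \<Omega>) w \<le> C\<^sub>P * Lp_norm p (lebesgue_on \<Omega>) (weak_grad \<Omega> w)"
    and trace: "Lp_norm p (surface_measure \<Omega>) (boundary_trace p \<Omega> w)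
      \<le> C\<^sub>T * Lp_norm p (lebesgue_on \<Omega>) (weak_grad \<Omega> w)"
  shows "\<bar>dF p \<Omega> h v w\<bar> \<le>
    (Lp_norm (conj_exp p) (lebesgue_on \<Omega>) (\<lambda>x. p_flux p (weak_grad \<Omega> v x) - \<eta> x)
      + C\<^sub>P * Lp_norm (conj_exp p) (lebesgue_on \<Omega>) (\<lambda>x. weak_div \<Omega> \<eta> x + h x)
      + C\<^sub>T * Lp_norm (conj_exp p) (surface_measure \<Omega>) (normal_trace p \<Omega> \<eta>))
    * Lp_norm p (lebesgue_on \<Omega>) (weak_grad \<Omega> w)"
proof -
  let ?M = "lebesgue_on \<Omega>" and ?q = "conj_exp p"
  let ?\<tau> = "\<lambda>x. p_flux p (weak_grad \<Omega> v x)" and ?d = "weak_div \<Omega> \<eta>" and ?g = "normal_trace p \<Omega> \<eta>"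
  have q1: "?q \<ge> 1" using conj_exp_facts(1)[OF p] by simp
  have \<eta>L: "\<eta> \<in> Lp ?q ?M" using \<eta> by (simp add: Q_nu_def)
  have dL: "?d \<in> Lp ?q ?M" by (rule weak_div_Lp[OF \<Omega> \<eta>])
  have \<tau>L: "?\<tau> \<in> Lp ?q ?M" by (rule p_flux_Lp[OF p W1pD(3)[OF \<Omega> v]])
  have \<tau>\<eta>: "(\<lambda>x. ?\<tau> x - \<eta> x) \<in> Lp ?q ?M" by (rule Lp_diff[OF q1 \<tau>L \<eta>L])
  have "(\<lambda>x. - h x) \<in> Lp ?q ?M" using h by (simp add: Lp_def)
  then have dh: "(\<lambda>x. ?d x + h x) \<in> Lp ?q ?M" using Lp_diff[OF q1 dL, of "\<lambda>x. - h x"] by simp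
  note wL = W1pD(1,3)[OF \<Omega> w]
  have "\<exists>g. is_normal_trace p \<Omega> \<eta> g" using \<eta> by (simp add: Q_nu_def)
  then have "is_normal_trace p \<Omega> \<eta> ?g"
    unfolding normal_trace_def by (rule someI_ex[where P = "is_normal_trace p \<Omega> \<eta>"])
  then have gL: "?g \<in> Lp ?q (surface_measure \<Omega>)"
    and green: "(LINT x|?M. \<eta> x \<bullet> weak_grad \<Omega> w x) + (LINT x|?M. ?d x * w x)
      = (LINT x|surface_measure \<Omega>. boundary_trace p \<Omega> w x * ?g x)"
    using w by (auto simp: is_normal_trace_def)
  have triangle: "\<bar>a - b + c\<bar> \<le> \<bar>a\<bar> + \<bar>b\<bar> + \<bar>c\<bar>" for a b c :: real by linarith
  have commute: "(LINT x|surface_measure \<Omega>. ?g x * boundary_trace p \<Omega> w x)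
      = (LINT x|surface_measure \<Omega>. boundary_trace p \<Omega> w x * ?g x)"
    by (simp only: mult.commute)
  have i1: "\<bar>LINT x|?M. (?\<tau> x - \<eta> x) \<bullet> weak_grad \<Omega> w x\<bar>
      \<le> Lp_norm ?q ?M (\<lambda>x. ?\<tau> x - \<eta> x) * Lp_norm p ?M (weak_grad \<Omega> w)"
    by (rule Holder_inner(2)[OF p \<tau>\<eta> wL(2)])
  have i2: "\<bar>LINT x|?M. (?d x + h x) * w x\<bar> \<le> Lp_norm ?q ?M (\<lambda>x. ?d x + h x) * Lp_norm p ?M w"
    by (rule Holder_mult(2)[OF p dh wL(1)])
  have i3: "\<bar>LINT x|surface_measure \<Omega>. ?g x * boundary_trace p \<Omega> w x\<bar>
      \<le> Lp_norm ?q (surface_measure \<Omega>) ?g * Lp_norm p (surface_measure \<Omega>) (boundary_trace p \<Omega> w)"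
    by (rule Holder_mult(2)[OF p gL boundary_trace_Lp])
  have split: "dF p \<Omega> h v w = (LINT x|?M. (?\<tau> x - \<eta> x) \<bullet> weak_grad \<Omega> w x)
      - (LINT x|?M. (?d x + h x) * w x) + (LINT x|surface_measure \<Omega>. ?g x * boundary_trace p \<Omega> w x)"
    unfolding commute dF_def using green Holder_inner(1)[OF p \<tau>L wL(2)] Holder_inner(1)[OF p \<eta>L wL(2)]
      Holder_mult(1)[OF p dL wL(1)] Holder_mult(1)[OF p h wL(1)]
    by (simp add: inner_diff_left distrib_right)
  have "\<bar>dF p \<Omega> h v w\<bar> \<le> Lp_norm ?q ?M (\<lambda>x. ?\<tau> x - \<eta> x) * Lp_norm p ?M (weak_grad \<Omega> w)
      + Lp_norm ?q ?M (\<lambda>x. ?d x + h x) * Lp_norm p ?M w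
      + Lp_norm ?q (surface_measure \<Omega>) ?g * Lp_norm p (surface_measure \<Omega>) (boundary_trace p \<Omega> w)"
    unfolding split
    by (intro order_trans[OF triangle] add_mono i1 i2 i3)
  also have "\<dots> \<le> Lp_norm ?q ?M (\<lambda>x. ?\<tau> x - \<eta> x) * Lp_norm p ?M (weak_grad \<Omega> w)
      + Lp_norm ?q ?M (\<lambda>x. ?d x + h x) * (C\<^sub>P * Lp_norm p ?M (weak_grad \<Omega> w))
      + Lp_norm ?q (surface_measure \<Omega>) ?g * (C\<^sub>T * Lp_norm p ?M (weak_grad \<Omega> w))"
    by (intro add_mono mult_left_mono order_refl poincare trace Lp_norm_nonneg)
  finally show ?thesis by (simp add: algebra_simps)
qed

section \<open>The two error estimates\<close>

theorem theorem5p3: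
  fixes p C\<^sub>P C\<^sub>T :: real and \<Omega> :: "'a::euclidean_space set" and h u v :: "'a \<Rightarrow> real"
  assumes p: "p > 1"
    and \<Omega>: "bounded_lipschitz_domain \<Omega>"
    and h_Lp: "h \<in> Lp (conj_exp p) (lebesgue_on \<Omega>)"
    and h_nonzero: "\<not> (AE x in lebesgue_on \<Omega>. h x = 0)"
    and h_mean: "(LINT x|lebesgue_on \<Omega>. h x) = 0"
    and poincare: "\<And>w. w \<in> W1p p \<Omega> \<Longrightarrow> (LINT x|lebesgue_on \<Omega>. w x) = 0 \<Longrightarrow>
      Lp_norm p (lebesgue_on \<Omega>) w \<le> C\<^sub>P * Lp_norm p (lebesgue_on \<Omega>) (weak_grad \<Omega> w)"
    and trace_ineq: "\<And>w. w \<in> W1p p \<Omega> \<Longrightarrow> (LINT x|lebesgue_on \<Omega>. w x) = 0 \<Longrightarrow>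
      Lp_norm p (surface_measure \<Omega>) (boundary_trace p \<Omega> w)
        \<le> C\<^sub>T * Lp_norm p (lebesgue_on \<Omega>) (weak_grad \<Omega> w)"
    and u_W1p: "u \<in> W1p p \<Omega>"
    and u_mean: "(LINT x|lebesgue_on \<Omega>. u x) = 0"
    and u_weak: "\<And>\<xi>. \<xi> \<in> W1p p \<Omega> \<Longrightarrow>
      (LINT x|lebesgue_on \<Omega>. p_flux p (weak_grad \<Omega> u x) \<bullet> weak_grad \<Omega> \<xi> x)
        = (LINT x|lebesgue_on \<Omega>. h x * \<xi> x)"
    and v_W1p: "v \<in> W1p p \<Omega>"
  shows "Lp_norm p (lebesgue_on \<Omega>) (weak_grad \<Omega> (\<lambda>x. u x - v x))
           \<le> error_const p \<Omega> C\<^sub>P h v * dF_norm p \<Omega> h v powr (1 / max 1 (p - 1)) \<and>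
         error_const p \<Omega> C\<^sub>P h v * dF_norm p \<Omega> h v powr (1 / max 1 (p - 1))
           \<le> error_const p \<Omega> C\<^sub>P h v *
             (INF \<eta> \<in> Q_nu p \<Omega>.
               (Lp_norm (conj_exp p) (lebesgue_on \<Omega>) (\<lambda>x. p_flux p (weak_grad \<Omega> v x) - \<eta> x)
                + C\<^sub>P * Lp_norm (conj_exp p) (lebesgue_on \<Omega>) (\<lambda>x. weak_div \<Omega> \<eta> x + h x)
                + C\<^sub>T * Lp_norm (conj_exp p) (surface_measure \<Omega>) (normal_trace p \<Omega> \<eta>))
               powr (1 / max 1 (p - 1)))"
proof -
  let ?M = "lebesgue_on \<Omega>" and ?q = "conj_exp p" and ?G = "weak_grad \<Omega>"
  have op: "open \<Omega>" and bd: "bounded \<Omega>" and ne: "\<Omega> \<noteq> {}"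
    using \<Omega> by (auto simp: bounded_lipschitz_domain_def)
  have lm: "\<Omega> \<in> lmeasurable"
    using op bd by (intro bounded_set_imp_lmeasurable) auto
  interpret finite_measure ?M
    by (rule finite_measure_lebesgue_on[OF lm])
  have p0: "p > 0" and p1: "p \<ge> 1" and q1: "?q \<ge> 1"
    using p conj_exp_facts(1)[OF p] by auto
  note uL = W1pD[OF op u_W1p] and vL = W1pD[OF op v_W1p]
  define U where "U = Lp_norm p ?M (?G u)"
  define H where "H = Lp_norm ?q ?M h"
  define \<alpha> where "\<alpha> = 1 / max 1 (p - 1)"
  define C where "C = error_const p \<Omega> C\<^sub>P h v"
  define W where "W = {w \<in> W1p p \<Omega>. \<not> (AE x in ?M. w x = 0) \<and> (LINT x|?M. w x) = 0}"
  define R where "R = (\<lambda>w. \<bar>dF p \<Omega> h v w\<bar> / Lp_norm p ?M (?G w))"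
  define D where "D = dF_norm p \<Omega> h v"
  define S where "S = (\<lambda>\<eta>. Lp_norm ?q ?M (\<lambda>x. p_flux p (?G v x) - \<eta> x)
    + C\<^sub>P * Lp_norm ?q ?M (\<lambda>x. weak_div \<Omega> \<eta> x + h x)
    + C\<^sub>T * Lp_norm ?q (surface_measure \<Omega>) (normal_trace p \<Omega> \<eta>))"
  have D_eq: "D = (SUP w\<in>W. R w)"
    unfolding D_def dF_norm_def W_def R_def ..
  have \<alpha>: "\<alpha> \<ge> 0" by (simp add: \<alpha>_def)

  \<comment> \<open>If the gradient of u vanished, the equation for u would make h orthogonal to all
    test functions, hence 0 almost everywhere.\<close>
  have U_pos: "U > 0"
  proof (rule ccontr)
    assume "\<not> U > 0"
    then have "U = 0" using Lp_norm_nonneg[of p ?M "?G u"] by (simp add: U_def)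
    then have G0: "AE x in ?M. ?G u x = 0"
      using Lp_norm_eq_0_iff[OF p0 uL(3)] by (simp add: U_def)
    have "AE x in ?M. h x = 0"
    proof (rule fundamental_lemma_calculus_of_variations[OF op])
      show "locally_integrable \<Omega> h"
        by (rule integrable_imp_locally_integrable[OF op Lp_imp_integrable[OF q1 h_Lp]])
      fix \<phi> assume \<phi>: "\<phi> \<in> test_functions \<Omega>"
      have "AE x in ?M. p_flux p (?G u x) \<bullet> ?G \<phi> x = 0"
        using G0 by eventually_elim (simp add: p_flux_def)
      then have "(LINT x|?M. p_flux p (?G u x) \<bullet> ?G \<phi> x) = 0"
        by (rule integral_eq_zero_AE)
      then show "(LINT x|?M. \<phi> x * h x) = 0"
        using u_weak[OF test_function_in_W1p[OF op bd p0 \<phi>]] by (simp only: mult.commute)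
    qed
    with h_nonzero show False by contradiction
  qed
  have C\<^sub>P: "C\<^sub>P \<ge> 0"
  proof -
    have "0 \<le> C\<^sub>P * U"
      using poincare[OF u_W1p u_mean] Lp_norm_nonneg[of p ?M u] unfolding U_def by linarith
    then show ?thesis using U_pos by (simp add: zero_le_mult_iff)
  qed
  have u_W: "u \<in> W"
  proof -
    have "\<not> (AE x in ?M. u x = 0)"
      using weak_grad_AE_0[OF op bd uL(2)] U_pos Lp_norm_eq_0_iff[OF p0 uL(3)] by (auto simp: U_def)
    then show ?thesis using u_W1p u_mean by (simp add: W_def)
  qed
  \<comment> \<open>The denominators in the dual norm are positive: with mean zero and vanishing
    gradient, the Poincare inequality would give w = 0.\<close>
  have W_pos: "0 < Lp_norm p ?M (?G w)" if "w \<in> W" for w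
  proof (rule ccontr)
    assume "\<not> 0 < Lp_norm p ?M (?G w)"
    then have "Lp_norm p ?M (?G w) = 0" using Lp_norm_nonneg[of p ?M "?G w"] by simp
    moreover have w: "w \<in> W1p p \<Omega>" "(LINT x|?M. w x) = 0" "\<not> (AE x in ?M. w x = 0)"
      using that by (auto simp: W_def)
    ultimately have "Lp_norm p ?M w = 0"
      using poincare[OF w(1,2)] Lp_norm_nonneg[of p ?M w] by simp
    then show False
      using Lp_norm_eq_0_iff[OF p0 W1pD(1)[OF op w(1)]] w(3) by simp
  qed
  have R_le: "R w \<le> S \<eta>" if "w \<in> W" "\<eta> \<in> Q_nu p \<Omega>" for w \<eta>
  proof -
    have w: "w \<in> W1p p \<Omega>" "(LINT x|?M. w x) = 0"
      using that(1) by (auto simp: W_def)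
    show ?thesis
      unfolding R_def S_def pos_divide_le_eq[OF W_pos[OF that(1)]]
      by (rule dF_le_majorant[OF p op h_Lp v_W1p w(1) that(2) poincare[OF w] trace_ineq[OF w]])
  qed
  have Q0: "(\<lambda>_. 0) \<in> Q_nu p \<Omega>" by (rule zero_in_Q_nu[OF op bd])
  \<comment> \<open>A supremum of reals is meaningful only for a set bounded above; the majorant at
    the zero field is such a bound.\<close>
  have bdd: "bdd_above (R ` W)"
    using R_le[OF _ Q0] by (intro bdd_aboveI2)
  have R_D: "R w \<le> D" if "w \<in> W" for w
    unfolding D_eq using bdd that by (rule cSUP_upper[rotated])
  have D0: "0 \<le> D"
    using R_D[OF u_W] Lp_norm_nonneg[of p ?M "?G u"] by (auto simp: R_def intro: order_trans[rotated])
  have D_S: "D \<le> S \<eta>" if "\<eta> \<in> Q_nu p \<Omega>" for \<eta>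
    unfolding D_eq using u_W R_le[OF _ that] by (intro cSUP_least) auto
  have C0: "0 \<le> C"
    using p by (simp add: C_def error_const_def)

  \<comment> \<open>Since 0 <= D <= \<open>S \<eta>\<close> and the exponent is nonnegative, taking
    powers preserves the order, and the lower bound passes to the infimum.\<close>
  have second: "C * D powr \<alpha> \<le> C * (INF \<eta>\<in>Q_nu p \<Omega>. S \<eta> powr \<alpha>)"
    using C0 Q0 D0 \<alpha> D_S by (intro mult_left_mono cINF_greatest powr_mono2) auto

  define N where "N = Lp_norm p ?M (\<lambda>x. ?G u x - ?G v x)"
  note uv = W1p_diff[OF op p1 u_W1p v_W1p]
  have ab: "(\<lambda>x. ?G u x - ?G v x) \<in> Lp p ?M"
    by (rule Lp_diff[OF p1 uL(3) vL(3)])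
  \<comment> \<open>The gradient chosen for u - v agrees with the difference of the chosen gradients
    only almost everywhere, which the norm does not see.\<close>
  have N_eq: "Lp_norm p ?M (?G (\<lambda>x. u x - v x)) = N"
    unfolding N_def by (rule Lp_norm_cong_AE[OF LpD(1)[OF W1pD(3)[OF op uv(1)]] LpD(1)[OF ab] uv(2)])
  have first: "N \<le> C * D powr \<alpha>"
  proof (cases "N = 0")
    case True
    then show ?thesis using C0 by simp
  next
    case False
    then have N: "N > 0" using Lp_norm_nonneg[of p ?M "\<lambda>x. ?G u x - ?G v x"] by (simp add: N_def)
    \<comment> \<open>Subtracting the mean of u - v makes w admissible in the dual norm and leaves
      the gradient unchanged. The division is genuine because a nonempty open set has positive
      measure.\<close>
    define c where "c = (LINT x|?M. u x - v x) / measure ?M \<Omega>"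
    define w where "w = (\<lambda>x. u x - v x - c)"
    have w: "w \<in> W1p p \<Omega>" "AE x in ?M. ?G w x = ?G u x - ?G v x"
    proof -
      note d = W1p_diff[OF op p1 uv(1) W1p_const[OF op bd, of c]]
      show "w \<in> W1p p \<Omega>" using d(1) by (simp add: w_def)
      have "AE x in ?M. ?G (\<lambda>_. c) x = 0"
        by (rule weak_grad_AE_eq[OF op is_weak_grad_const[OF op bd]])
      then show "AE x in ?M. ?G w x = ?G u x - ?G v x"
        using d(2) uv(2) unfolding w_def by eventually_elim simp
    qed
    have w_mean: "(LINT x|?M. w x) = 0"
    proof -
      have "measure lebesgue \<Omega> \<noteq> 0"
        using open_not_negligible[OF op ne] lm negligible_iff_measure by blast
      then have "measure ?M \<Omega> \<noteq> 0"
        using op by (simp add: measure_restrict_space)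
      moreover have "integrable ?M (\<lambda>x. u x - v x)"
        by (rule Lp_imp_integrable[OF p1 W1pD(1)[OF op uv(1)]])
      ultimately show ?thesis
        unfolding w_def by (simp add: c_def)
    qed
    have Gw: "?G w \<in> borel_measurable ?M" by (rule LpD(1)[OF W1pD(3)[OF op w(1)]])
    have N_w: "Lp_norm p ?M (?G w) = N"
      unfolding N_def by (rule Lp_norm_cong_AE[OF Gw LpD(1)[OF ab] w(2)])
    have "\<not> (AE x in ?M. w x = 0)"
      using weak_grad_AE_0[OF op bd W1pD(2)[OF op w(1)]] N N_w
        Lp_norm_eq_0_iff[OF p0 W1pD(3)[OF op w(1)]] by auto
    then have "w \<in> W"
      using w(1) w_mean by (simp add: W_def)
    then have dF_w: "\<bar>dF p \<Omega> h v w\<bar> \<le> D * N"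
      using R_D[of w] N by (simp add: R_def N_w pos_divide_le_eq)
    note \<tau>u = p_flux_Lp[OF p uL(3)] and \<tau>v = p_flux_Lp[OF p vL(3)]
    have "(LINT x|?M. (p_flux p (?G u x) - p_flux p (?G v x)) \<bullet> (?G u x - ?G v x))
        = (LINT x|?M. (p_flux p (?G u x) - p_flux p (?G v x)) \<bullet> ?G w x)"
    proof (rule integral_cong_AE)
      show "AE x in ?M. (p_flux p (?G u x) - p_flux p (?G v x)) \<bullet> (?G u x - ?G v x)
          = (p_flux p (?G u x) - p_flux p (?G v x)) \<bullet> ?G w x"
        using w(2) by eventually_elim simp
    qed (use LpD(1)[OF \<tau>u] LpD(1)[OF \<tau>v] LpD(1)[OF ab] Gw in \<open>auto intro!: borel_measurable_inner borel_measurable_diff\<close>)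
    also have "\<dots> = - dF p \<Omega> h v w"
      using u_weak[OF w(1)] Holder_inner(1)[OF p \<tau>u W1pD(3)[OF op w(1)]]
        Holder_inner(1)[OF p \<tau>v W1pD(3)[OF op w(1)]]
      by (simp add: dF_def inner_diff_left)
    finally have energy: "(LINT x|?M. (p_flux p (?G u x) - p_flux p (?G v x)) \<bullet> (?G u x - ?G v x)) \<le> D * N"
      using dF_w by linarith
    show ?thesis
    proof (cases "p \<ge> 2")
      case True
      then have "max 1 (p - 1) = p - 1" by simp
      then show ?thesis
        using p_flux_strong_monotone_ge_2[OF True uL(3) vL(3) N_def N D0 energy] True
        by (simp add: C_def \<alpha>_def error_const_def)
    next
      case False
      then have p2: "p < 2" by simp
      \<comment> \<open>A priori bound: test the equation with u itself, divide by U > 0, and raise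
        to the conjugate exponent, using (p-1) p' = p. The result replaces the norm of the gradient
        of u by the data term in the bracket of the error constant.\<close>
      have "U powr p = (LINT x|?M. p_flux p (?G u x) \<bullet> ?G u x)"
        using p0 by (simp add: U_def Lp_norm_powr p_flux_inner_self)
      also have "\<dots> = (LINT x|?M. h x * u x)" by (rule u_weak[OF u_W1p])
      also have "\<dots> \<le> H * Lp_norm p ?M u"
        using Holder_mult(2)[OF p h_Lp uL(1)] by (simp add: H_def)
      also have "\<dots> \<le> H * (C\<^sub>P * U)"
        unfolding U_def H_def by (intro mult_left_mono poincare u_W1p u_mean Lp_norm_nonneg)
      finally have "U powr (p - 1) \<le> C\<^sub>P * H"
        using U_pos powr_eq_mult_powr_minus_one[of U p] by (simp add: mult_ac)
      then have "(U powr (p - 1)) powr ?q \<le> (C\<^sub>P * H) powr ?q"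
        using q1 by (intro powr_mono2) auto
      moreover have "0 \<le> H" by (simp add: H_def Lp_norm_nonneg)
      ultimately have U_le: "U powr p \<le> C\<^sub>P powr ?q * H powr ?q"
        using C\<^sub>P by (simp add: powr_powr conj_exp_facts(3)[OF p] powr_mult)
      have "\<alpha> = 1" using p2 by (simp add: \<alpha>_def)
      then show ?thesis
        using p_flux_strong_monotone_less_2[OF p p2 uL(3) vL(3) N_def N energy add_right_mono[OF U_le[unfolded U_def]]]
          False D0
        by (simp add: C_def error_const_def H_def)
    qed
  qed
  show ?thesis
    using first second unfolding N_eq C_def D_def S_def \<alpha>_def by (rule conjI)
qed

end
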